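(* For any $r,d\in\mathbb{N}$, $\delta\in(0,1)$ and $\varepsilon\in(0,\delta]$ we have $$ n^{\rm per}(\varepsilon,d,r)\;\ge\;(1-\delta)\,c_r^d\left(\frac{\delta\,d}{\varepsilon}\right)^{d/r}\qquad\text{with}\qquad c_r=\frac{1}{4\,e\,r^{1-1/r}}. $$ Taking $\delta=d/(d+r)$, which maximizes the right-hand side as a function of $\delta\in(0,1)$, one obtains, for all $\varepsilon\in(0,d/(d+r)]$, $$ n^{\rm per}(\varepsilon,d,r)\;\ge\;\frac{r}{r+d}\left(\frac{d}{d+r}\;\frac{1}{4^r e^r r^{r-1}}\;\frac{d}{\varepsilon}\right)^{d/r}. $$ Here $e$ denotes Euler's number.
   Context: Here $\mathbb{N}=\{1,2,\dots\}$, $\mathbb{N}_0=\{0,1,2,\dots\}$, and $|\beta|_1=\beta_1+\dots+\beta_d$ for $\beta\in\mathbb{N}_0^d$; $D^\beta$ is the partial derivative of order $\beta$. Let $\mathcal{C}^r_\pi$ be the class of all $r$-times continuously differentiable functions $f:\mathbb{R}^d\to\mathbb{R}$ that are 1-periodic, i.e., $f(x+v)=f(x)$ for all $x\in\mathbb{R}^d$ and all $v\in\{0,1\}^d$, and satisfy $\sup_{x\in\mathbb{R}^d}|(D^\beta f)(x)|\le 1$ for all $\beta\in\mathbb{N}_0^d$ with $|\beta|_1\le r$. The problem is to approximate $S_d(f)=\int_{[0,1]^d} f(x)\,dx$ for $f\in\mathcal{C}^r_\pi$. An algorithm using $n$ function values is a map $A_n:\mathcal{C}^r_\pi\to\mathbb{R}$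 of the form $A_n(f)=\phi_n(f(x_1),\dots,f(x_n))$, where $\phi_n:\mathbb{R}^n\to\mathbb{R}$ is an arbitrary (possibly nonlinear) map and the sample points $x_i\in[0,1]^d$ may be chosen adaptively, i.e., $x_i$ may depend on the already computed values $f(x_1),\dots,f(x_{i-1})$ (for $n=0$, $A_0$ is a constant). Its worst case error is $e(A_n)=\sup_{f\in\mathcal{C}^r_\pi}|S_d(f)-A_n(f)|$, and the $n$th minimal error is $e_n(\mathcal{C}^r_\pi)=\inf_{A_n}e(A_n)$, the infimum being over all such algorithms. Define $$n^{\rm per}(\varepsilon,d,r)=\min\{n\in\mathbb{N}_0:\ e_n(\mathcal{C}^r_\pi)\le\varepsilon\}.$$ *)

theory Defs
  imports "HOL-Analysis.Analysis"
begin

definition partial_deriv :: "'d::finite \<Rightarrow> (real^'d \<Rightarrow> real) \<Rightarrow> real^'d \<Rightarrow> real" where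
  "partial_deriv i f x = deriv (\<lambda>t. f (x + t *\<^sub>R axis i 1)) 0"

primrec cont_differentiable :: "nat \<Rightarrow> (real^'d::finite \<Rightarrow> real) \<Rightarrow> bool" where
  "cont_differentiable 0 f \<longleftrightarrow> continuous_on UNIV f"
| "cont_differentiable (Suc k) f \<longleftrightarrow> continuous_on UNIV f \<and>
     (\<forall>i. (\<forall>x. (\<lambda>t. f (x + t *\<^sub>R axis i 1)) differentiable at 0) \<and>
          cont_differentiable k (partial_deriv i f))"

text \<open>The derivative of multi-index order \<open>\<beta>\<close>. The index type carries no order, so an
  arbitrary order of differentiation is chosen; by Schwarz's theorem it is immaterial for
  \<open>r\<close>-times continuously differentiable functions when \<open>\<beta>\<close> has total order at most \<open>r\<close>.\<close>

definition mixed_partial :: "('d::finite \<Rightarrow> nat) \<Rightarrow> (real^'d \<Rightarrow> real) \<Rightarrow> real^'d \<Rightarrow> real" where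
  "mixed_partial \<beta> f = foldr partial_deriv (SOME js. \<forall>i. count_list js i = \<beta> i) f"

definition C_per :: "nat \<Rightarrow> (real^'d::finite \<Rightarrow> real) set" where
  "C_per r = {f. cont_differentiable r f \<and>
     (\<forall>x v. (\<forall>i. v $ i \<in> {0, 1}) \<longrightarrow> f (x + v) = f x) \<and>
     (\<forall>\<beta>. (\<Sum>i\<in>UNIV. \<beta> i) \<le> r \<longrightarrow> (SUP x. ereal \<bar>mixed_partial \<beta> f x\<bar>) \<le> 1)}"

definition S_int :: "(real^'d::finite \<Rightarrow> real) \<Rightarrow> real" where
  "S_int f = integral (cbox 0 1) f"

text \<open>The list \<open>[f x\<^sub>1, \<dots>, f x\<^sub>n]\<close> of the first \<open>n\<close> computed values, where the sampling rule
  \<open>\<psi>\<close> yields the next sample point from the list of values computed so far.\<close>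

primrec info :: "(real list \<Rightarrow> real^'d::finite) \<Rightarrow> nat \<Rightarrow> (real^'d \<Rightarrow> real) \<Rightarrow> real list" where
  "info \<psi> 0 f = []"
| "info \<psi> (Suc n) f = info \<psi> n f @ [f (\<psi> (info \<psi> n f))]"

definition algorithms ::
    "nat \<Rightarrow> (real^'d::finite \<Rightarrow> real) set \<Rightarrow> ((real^'d \<Rightarrow> real) \<Rightarrow> real) set" where
  "algorithms n F = {A. \<exists>\<phi> \<psi>. (\<forall>ys. length ys < n \<longrightarrow> \<psi> ys \<in> cbox 0 1) \<and>
     (\<forall>f\<in>F. A f = \<phi> (info \<psi> n f))}"

definition wc_error ::
    "(real^'d::finite \<Rightarrow> real) set \<Rightarrow> ((real^'d \<Rightarrow> real) \<Rightarrow> real) \<Rightarrow> ereal" where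
  "wc_error F A = (SUP f\<in>F. ereal \<bar>S_int f - A f\<bar>)"

definition minimal_error :: "nat \<Rightarrow> (real^'d::finite \<Rightarrow> real) set \<Rightarrow> ereal" where
  "minimal_error n F = (INF A\<in>algorithms n F. wc_error F A)"

text \<open>The dimension is that of the index type \<open>'d\<close>, that is, \<open>CARD('d)\<close>.\<close>

definition n_per :: "'d::finite itself \<Rightarrow> real \<Rightarrow> nat \<Rightarrow> nat" where
  "n_per _ \<epsilon> r = (LEAST n. minimal_error n (C_per r :: (real^'d \<Rightarrow> real) set) \<le> ereal \<epsilon>)"

definition c_const :: "nat \<Rightarrow> real" where
  "c_const r = 1 / (4 * exp 1 * real r powr (1 - 1 / real r))"

end

theory Submission
  imports Defs
begin

text \<open>The lower bound comes from a fooling function. Fix an algorithm with \<open>n\<close> function values and let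
  \<open>P\<close> be the set of points that it visits when all values it sees are zero. If \<open>f\<close> vanishes on
  \<open>P\<close>, then \<open>f\<close> and \<open>-f\<close> yield the same information, so the algorithm treats them alike and its
  error on one of them is at least \<open>S_int f\<close> (\<open>minimal_error_lower_bound\<close>). Hence, for every set
  \<open>P\<close> of at most \<open>n\<close> points, a function in the class is needed that vanishes on \<open>P\<close> and has a
  large integral (\<open>exists_fooling_function\<close>).

  Let \<open>D\<close> be the 1-periodic \<open>\<ell>\<^sub>1\<close> distance. Its balls of radius \<open>R\<close> have volume at most
  \<open>(2 e R / d) ^ d\<close>; the \<open>d\<close> in this denominator is the source of the factor \<open>d\<close> inside the
  power in the final bound. Start from the plateau
  \<open>g x = min V (L * max 0 (D x P - \<rho>))\<close>: it vanishes within distance \<open>\<rho>\<close> of \<open>P\<close>, equals \<open>V\<close>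
  beyond distance \<open>R = \<rho> + V / L\<close>, and has Lipschitz constant \<open>L\<close> along every axis, so that its
  integral is at least \<open>V\<close> times one minus the volume of \<open>n\<close> balls of radius \<open>R\<close>. Averaging over
  a cube of half-width \<open>h\<close> keeps the lower bound for the integral, the periodicity and all bounds
  known so far; it shrinks the radius of vanishing by \<open>d * h\<close>, and it adds one order of
  differentiability whose bound is \<open>1 / h\<close> times the previous one. One average of tiny half-width
  \<open>\<eta>\<close> makes \<open>g\<close> continuously differentiable with first derivatives still bounded by \<open>L\<close>;
  \<open>r - 1\<close> further averages of half-width \<open>h\<close> then give derivatives of order \<open>m + 1\<close> bounded by
  \<open>L / h ^ m\<close>.

  The choice \<open>L = h ^ (r - 1)\<close>, \<open>V = d * h ^ r\<close> bounds all derivatives of positive order by 1.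
  With \<open>d * h ^ r = \<epsilon> / \<delta>\<close> the function itself is bounded by 1 exactly because \<open>\<epsilon> \<le> \<delta>\<close>, and its
  integral exceeds \<open>\<epsilon>\<close> as soon as the balls have total volume below \<open>1 - \<delta>\<close>. The radius of
  vanishing that is needed is \<open>\<rho> = (r - 1) * d * h + d * \<eta>\<close>, hence \<open>R = d * (r * h + \<eta>)\<close>. As
  \<open>r < 2 ^ r\<close>, some \<open>\<eta> > 0\<close> satisfies \<open>r * h + \<eta> = 2 * r powr (1 - 1 / r) * h\<close>, and then a ball
  has volume at most \<open>1 / (c_r ^ d * (\<delta> * d / \<epsilon>) powr (d / r))\<close>. This is the first claim
  (\<open>n_per_lower_bound\<close>).

  Because \<open>n_per\<close> is a least number with a certain property, the argument also needs that some
  number has it; this holds since the class is uniformly Lipschitz (\<open>exists_small_minimal_error\<close>).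
  The optimal \<open>\<delta>\<close> comes from \<open>ln u \<le> u - 1\<close> (\<open>one_minus_times_powr_le\<close>).\<close>

section \<open>Partial derivatives\<close>

lemma partial_deriv_line:
  fixes f :: "real^'d::finite \<Rightarrow> real"
  assumes "\<And>x. (\<lambda>t. f (x + t *\<^sub>R axis i 1)) differentiable at 0"
  shows "((\<lambda>t. f (x + t *\<^sub>R axis i 1)) has_real_derivative
           partial_deriv i f (x + t *\<^sub>R axis i 1)) (at t)"
proof -
  let ?y = "x + t *\<^sub>R axis i 1"
  have "((\<lambda>s. f (?y + s *\<^sub>R axis i 1)) has_real_derivative partial_deriv i f ?y) (at 0)"
    unfolding partial_deriv_def using assms[of ?y]
    by (simp add: DERIV_deriv_iff_real_differentiable)
  then have "((\<lambda>s. f (x + (s + t) *\<^sub>R axis i 1)) has_real_derivative partial_deriv i f ?y) (at 0)"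
    by (simp add: algebra_simps)
  then show ?thesis
    using DERIV_shift[of "\<lambda>t. f (x + t *\<^sub>R axis i 1)" _ 0 t] by simp
qed

lemma partial_derivI:
  fixes f :: "real^'d::finite \<Rightarrow> real"
  assumes "\<And>x. ((\<lambda>t. f (x + t *\<^sub>R axis i 1)) has_real_derivative g x) (at 0)"
  shows "(\<lambda>t. f (x + t *\<^sub>R axis i 1)) differentiable at 0" and "partial_deriv i f = g"
  using assms unfolding partial_deriv_def
  by (auto simp: DERIV_imp_deriv real_differentiable_def)

lemma exists_list_with_counts:
  fixes \<beta> :: "'d::finite \<Rightarrow> nat"
  shows "\<exists>js. \<forall>i. count_list js i = \<beta> i"
proof -
  obtain js where js: "mset js = (\<Sum>i\<in>UNIV. replicate_mset (\<beta> i) i)" using ex_mset by blast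
  have "count_list js i = \<beta> i" for i
  proof -
    have "count_list js i = count (mset js) i" by (induction js) auto
    then show ?thesis unfolding js by (simp add: count_sum if_distrib cong: if_cong)
  qed
  then show ?thesis by blast
qed

text \<open>The list chosen by \<open>SOME\<close> in \<open>mixed_partial\<close> has the right counts only because such a list
  exists. Its length is the order of \<open>\<beta>\<close>, which is what bounds by order depend on.\<close>
lemma mixed_partial_eq_foldr:
  fixes \<beta> :: "'d::finite \<Rightarrow> nat"
  obtains js where "mixed_partial \<beta> = foldr partial_deriv js" "\<And>i. count_list js i = \<beta> i"
    "length js = (\<Sum>i\<in>UNIV. \<beta> i)"
proof -
  define js where "js = (SOME js. \<forall>i. count_list js i = \<beta> i)"
  have c: "\<forall>i. count_list js i = \<beta> i"
    unfolding js_def by (rule someI_ex) (rule exists_list_with_counts)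
  have "length js = (\<Sum>i\<in>UNIV. \<beta> i)"
    using sum_count_set[of js UNIV] c by simp
  with c show thesis by (intro that[of js]) (auto simp: mixed_partial_def js_def)
qed

section \<open>Averages along one axis\<close>

definition axis_avg :: "'d::finite \<Rightarrow> real \<Rightarrow> (real^'d \<Rightarrow> real) \<Rightarrow> real^'d \<Rightarrow> real" where
  "axis_avg i h f x = integral {-h..h} (\<lambda>t. f (x + t *\<^sub>R axis i 1)) / (2 * h)"

lemma continuous_on_axis_line:
  fixes f :: "real^'d::finite \<Rightarrow> real"
  assumes "continuous_on UNIV f" "continuous_on S u" "continuous_on S s"
  shows "continuous_on S (\<lambda>z. f (u z + s z *\<^sub>R axis i 1))"
  by (rule continuous_on_compose2[OF assms(1)]) (auto intro!: continuous_intros assms)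

lemma integrable_axis_line:
  fixes f :: "real^'d::finite \<Rightarrow> real"
  assumes "continuous_on UNIV f"
  shows "(\<lambda>t. f (x + t *\<^sub>R axis i 1)) integrable_on {a..b}"
  by (intro integrable_continuous_real continuous_on_axis_line[OF assms] continuous_intros)

lemma continuous_axis_avg:
  fixes f :: "real^'d::finite \<Rightarrow> real"
  assumes "continuous_on UNIV f"
  shows "continuous_on UNIV (axis_avg i h f)"
proof -
  have "continuous_on UNIV (\<lambda>x. integral (cbox (-h) h) (\<lambda>t. f (x + t *\<^sub>R axis i 1)))"
    by (rule integral_continuous_on_param)
       (auto simp: case_prod_unfold intro!: continuous_on_axis_line[OF assms] continuous_intros)
  then show ?thesis
    unfolding axis_avg_def divide_inverse by (auto intro!: continuous_intros)
qed

lemma axis_avg_le: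
  assumes "continuous_on UNIV f" "0 < h" "\<And>t. \<bar>t\<bar> \<le> h \<Longrightarrow> f (x + t *\<^sub>R axis i 1) \<le> B"
  shows "axis_avg i h f x \<le> B"
proof -
  have "integral {-h..h} (\<lambda>t. f (x + t *\<^sub>R axis i 1)) \<le> integral {-h..h} (\<lambda>t. B)"
    by (intro integral_le integrable_axis_line assms) auto
  then show ?thesis using assms by (simp add: axis_avg_def field_simps)
qed

lemma axis_avg_uminus: "axis_avg i h (\<lambda>x. - f x) x = - axis_avg i h f x"
  by (simp add: axis_avg_def)

lemma axis_avg_diff:
  assumes "continuous_on UNIV f" "continuous_on UNIV g"
  shows "axis_avg i h (\<lambda>x. f x - g x) x = axis_avg i h f x - axis_avg i h g x"
  by (simp add: axis_avg_def integral_diff integrable_axis_line assms diff_divide_distrib)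

lemma axis_avg_shift: "axis_avg i h f (x + v) = axis_avg i h (\<lambda>x. f (x + v)) x"
  by (simp add: axis_avg_def algebra_simps)

lemma abs_axis_avg_le:
  assumes "continuous_on UNIV f" "0 < h" "\<And>t. \<bar>t\<bar> \<le> h \<Longrightarrow> \<bar>f (x + t *\<^sub>R axis i 1)\<bar> \<le> B"
  shows "\<bar>axis_avg i h f x\<bar> \<le> B"
proof -
  have "axis_avg i h f x \<le> B"
    by (rule axis_avg_le) (use assms in \<open>auto simp: abs_le_iff\<close>)
  moreover have "axis_avg i h (\<lambda>x. - f x) x \<le> B"
    by (rule axis_avg_le) (use assms in \<open>auto simp: abs_le_iff intro!: continuous_intros\<close>)
  ultimately show ?thesis by (simp add: axis_avg_uminus abs_le_iff)
qed

text \<open>Differentiation under the integral sign.\<close>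
lemma partial_deriv_axis_avg_commute:
  fixes f :: "real^'d::finite \<Rightarrow> real"
  assumes diff: "\<And>x. (\<lambda>t. f (x + t *\<^sub>R axis j 1)) differentiable at 0"
    and f: "continuous_on UNIV f" and df: "continuous_on UNIV (partial_deriv j f)"
  shows "(\<lambda>t. axis_avg i h f (x + t *\<^sub>R axis j 1)) differentiable at 0"
    and "partial_deriv j (axis_avg i h f) = axis_avg i h (partial_deriv j f)"
proof -
  have *: "((\<lambda>s. axis_avg i h f (x + s *\<^sub>R axis j 1)) has_real_derivative
      axis_avg i h (partial_deriv j f) x) (at 0)" for x
  proof -
    have "((\<lambda>s. integral (cbox (-h) h) (\<lambda>t. f ((x + t *\<^sub>R axis i 1) + s *\<^sub>R axis j 1)))
        has_real_derivative
        integral (cbox (-h) h) (\<lambda>t. partial_deriv j f ((x + t *\<^sub>R axis i 1) + 0 *\<^sub>R axis j 1)))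
        (at 0 within UNIV)"
    proof (rule leibniz_rule_field_derivative)
      show "continuous_on (UNIV \<times> cbox (-h) h)
          (\<lambda>(s, t). partial_deriv j f ((x + t *\<^sub>R axis i 1) + s *\<^sub>R axis j 1))"
        unfolding case_prod_unfold by (intro continuous_on_axis_line[OF df] continuous_intros)
    qed (auto intro!: partial_deriv_line diff integrable_continuous_real
          continuous_on_axis_line[OF f] continuous_intros)
    from DERIV_cdivide[OF this, of "2 * h"] show ?thesis
      by (simp add: axis_avg_def algebra_simps)
  qed
  show "(\<lambda>t. axis_avg i h f (x + t *\<^sub>R axis j 1)) differentiable at 0"
    and "partial_deriv j (axis_avg i h f) = axis_avg i h (partial_deriv j f)"
    by (rule partial_derivI[OF *])+
qed

definition axis_quotient :: "'d::finite \<Rightarrow> real \<Rightarrow> (real^'d \<Rightarrow> real) \<Rightarrow> real^'d \<Rightarrow> real" where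
  "axis_quotient i h f x = (f (x + h *\<^sub>R axis i 1) - f (x - h *\<^sub>R axis i 1)) / (2 * h)"

lemma continuous_axis_quotient:
  assumes "continuous_on UNIV f"
  shows "continuous_on UNIV (axis_quotient i h f)"
proof -
  have "continuous_on UNIV (\<lambda>x. f (x + h *\<^sub>R axis i 1) - f (x + (- h) *\<^sub>R axis i 1))"
    by (intro continuous_on_axis_line[OF assms] continuous_intros)
  then show ?thesis
    unfolding axis_quotient_def divide_inverse by (auto intro!: continuous_intros)
qed

text \<open>In the direction of averaging, a merely continuous function becomes differentiable by the
  fundamental theorem of calculus.\<close>
lemma partial_deriv_axis_avg_same:
  fixes f :: "real^'d::finite \<Rightarrow> real"
  assumes f: "continuous_on UNIV f" and h: "0 < h"
  shows "(\<lambda>t. axis_avg i h f (x + t *\<^sub>R axis i 1)) differentiable at 0"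
    and "partial_deriv i (axis_avg i h f) = axis_quotient i h f"
proof -
  have *: "((\<lambda>s. axis_avg i h f (x + s *\<^sub>R axis i 1)) has_real_derivative
      axis_quotient i h f x) (at 0)" for x
  proof -
    let ?k = "\<lambda>t. f (x + t *\<^sub>R axis i 1)"
    let ?a = "- (2 * h)" and ?b = "2 * h"
    have c: "continuous_on S ?k" for S by (intro continuous_on_axis_line[OF f] continuous_intros)
    \<comment> \<open>The interval \<open>{?a..?b}\<close> contains \<open>{-h + s..h + s}\<close> in its interior for all small \<open>s\<close>.\<close>
    define P where "P u = integral {?a..u} ?k" for u
    have P: "(P has_real_derivative ?k u) (at u)" if "u \<in> {?a<..<?b}" for u
      unfolding P_def using integral_has_real_derivative[OF c, of u ?a ?b] that
      by (simp add: at_within_Icc_at)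
    have eq: "axis_avg i h f (x + s *\<^sub>R axis i 1) = (P (h + s) - P (- h + s)) / (2 * h)"
      if "\<bar>s\<bar> < h" for s
    proof -
      have "integral {-h..h} (\<lambda>t. f (x + s *\<^sub>R axis i 1 + t *\<^sub>R axis i 1))
          = integral {-h..h} (\<lambda>t. ?k (t + s))"
        by (simp add: algebra_simps)
      also have "\<dots> = integral {-h+s..h+s} ?k"
        using integral_shift_Icc_real[of "-h" h ?k s] by (simp add: o_def algebra_simps)
      also have "\<dots> = P (h + s) - P (- h + s)"
      proof -
        have "integral {?a..-h+s} ?k + integral {-h+s..h+s} ?k = integral {?a..h+s} ?k"
          by (rule Henstock_Kurzweil_Integration.integral_combine)
             (use that in \<open>auto intro!: integrable_continuous_real c\<close>)
        then show ?thesis by (simp add: P_def)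
      qed
      finally show ?thesis by (simp add: axis_avg_def)
    qed
    have "((\<lambda>s. P (s + h)) has_real_derivative ?k h) (at 0)"
      using P[of h] h DERIV_shift[of P "?k h" 0 h] by simp
    moreover have "((\<lambda>s. P (s + - h)) has_real_derivative ?k (-h)) (at 0)"
      using P[of "-h"] h DERIV_shift[of P "?k (-h)" 0 "-h"] by simp
    ultimately have "((\<lambda>s. (P (s + h) - P (s + - h)) / (2 * h)) has_real_derivative
        (?k h - ?k (-h)) / (2 * h)) (at 0)"
      by (intro DERIV_cdivide DERIV_diff)
    then have "((\<lambda>s. axis_avg i h f (x + s *\<^sub>R axis i 1)) has_real_derivative
        (?k h - ?k (-h)) / (2 * h)) (at 0)"
      by (rule has_field_derivative_transform_within_open[where S = "{-h<..<h}"])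
         (use h eq in \<open>auto simp: algebra_simps\<close>)
    then show ?thesis by (simp add: axis_quotient_def)
  qed
  show "(\<lambda>t. axis_avg i h f (x + t *\<^sub>R axis i 1)) differentiable at 0"
    and "partial_deriv i (axis_avg i h f) = axis_quotient i h f"
    by (rule partial_derivI[OF *])+
qed

section \<open>Functions with bounded derivatives\<close>

text \<open>The sequence \<open>B\<close> bounds the derivatives by their order. Peeling off the derivative that is
  applied first matches the recursion of \<open>cont_differentiable\<close> and the way \<open>foldr\<close> applies a
  list of partial derivatives.\<close>
primrec smooth_bdd :: "nat \<Rightarrow> (nat \<Rightarrow> real) \<Rightarrow> (real^'d::finite \<Rightarrow> real) \<Rightarrow> bool" where
  "smooth_bdd 0 B f \<longleftrightarrow> continuous_on UNIV f \<and> (\<forall>x. \<bar>f x\<bar> \<le> B 0)"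
| "smooth_bdd (Suc k) B f \<longleftrightarrow> continuous_on UNIV f \<and> (\<forall>x. \<bar>f x\<bar> \<le> B 0) \<and>
     (\<forall>i. (\<forall>x. (\<lambda>t. f (x + t *\<^sub>R axis i 1)) differentiable at 0) \<and>
          smooth_bdd k (\<lambda>m. B (Suc m)) (partial_deriv i f))"

lemma smooth_bddD:
  assumes "smooth_bdd k B f"
  shows "continuous_on UNIV f" "\<bar>f x\<bar> \<le> B 0"
  using assms by (cases k; simp)+

lemma smooth_bdd_imp_cont_differentiable: "smooth_bdd k B f \<Longrightarrow> cont_differentiable k f"
  by (induction k arbitrary: B f) auto

lemma smooth_bdd_imp_foldr_bound:
  "smooth_bdd k B f \<Longrightarrow> length js \<le> k \<Longrightarrow> \<bar>foldr partial_deriv js f x\<bar> \<le> B (length js)"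
proof (induction js arbitrary: k B f rule: rev_induct)
  case Nil
  then show ?case by (simp add: smooth_bddD)
next
  case (snoc j js)
  then obtain k' where "k = Suc k'" by (cases k) auto
  with snoc.prems snoc.IH[of k' "\<lambda>m. B (Suc m)" "partial_deriv j f"] show ?case by auto
qed

lemma smooth_bdd_imp_C_per:
  fixes f :: "real^'d::finite \<Rightarrow> real"
  assumes f: "smooth_bdd r B f" and B: "\<And>m. m \<le> r \<Longrightarrow> B m \<le> 1"
    and per: "\<And>x v. (\<And>i. v $ i \<in> {0, 1}) \<Longrightarrow> f (x + v) = f x"
  shows "f \<in> C_per r"
proof -
  have "(SUP x. ereal \<bar>mixed_partial \<beta> f x\<bar>) \<le> 1" if "(\<Sum>i\<in>UNIV. \<beta> i) \<le> r" for \<beta> :: "'d \<Rightarrow> nat"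
  proof (rule SUP_least)
    fix x
    obtain js where "mixed_partial \<beta> = foldr partial_deriv js" "length js = (\<Sum>i\<in>UNIV. \<beta> i)"
      using mixed_partial_eq_foldr by blast
    then have "\<bar>mixed_partial \<beta> f x\<bar> \<le> 1"
      using smooth_bdd_imp_foldr_bound[OF f, of js x] B[of "length js"] that by simp
    then show "ereal \<bar>mixed_partial \<beta> f x\<bar> \<le> 1" by simp
  qed
  then show ?thesis
    using smooth_bdd_imp_cont_differentiable[OF f] per by (auto simp: C_per_def)
qed

lemma smooth_bdd_uminus: "smooth_bdd k B f \<Longrightarrow> smooth_bdd k B (\<lambda>x. - f x)"
proof (induction k arbitrary: B f)
  case 0
  then show ?case by (auto intro!: continuous_intros)
next
  case (Suc k)
  have "((\<lambda>t. - f (x + t *\<^sub>R axis i 1)) has_real_derivative - partial_deriv i f x) (at 0)" for i x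
    using DERIV_minus[OF partial_deriv_line[of f i x 0]] Suc.prems by auto
  note d = partial_derivI[OF this]
  show ?case using Suc by (auto simp: d intro!: continuous_intros)
qed

lemma smooth_bdd_axis_quotient:
  assumes h: "0 < h" and "smooth_bdd k B f"
  shows "smooth_bdd k (\<lambda>m. B m / h) (axis_quotient i h f)"
  using assms(2)
proof (induction k arbitrary: B f)
  have b: "\<bar>axis_quotient i h f x\<bar> \<le> C / h" if "\<And>x. \<bar>f x\<bar> \<le> C" for f x C
  proof -
    have "\<bar>f (x + h *\<^sub>R axis i 1) - f (x - h *\<^sub>R axis i 1)\<bar> \<le> C + C"
      using that[of "x + h *\<^sub>R axis i 1"] that[of "x - h *\<^sub>R axis i 1"] by linarith
    then show ?thesis using h by (simp add: axis_quotient_def abs_mult field_simps)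
  qed
  {
    case 0
    then show ?case by (simp add: b continuous_axis_quotient)
  next
    case (Suc k)
    have "((\<lambda>t. axis_quotient i h f (x + t *\<^sub>R axis j 1)) has_real_derivative
        axis_quotient i h (partial_deriv j f) x) (at 0)" for j x
    proof -
      have *: "((\<lambda>t. f (y + t *\<^sub>R axis j 1)) has_real_derivative partial_deriv j f y) (at 0)" for y
        using partial_deriv_line[of f j y 0] Suc.prems by auto
      show ?thesis
        using DERIV_cdivide[OF DERIV_diff[OF *[of "x + h *\<^sub>R axis i 1"] *[of "x - h *\<^sub>R axis i 1"]], of "2 * h"]
        by (simp add: axis_quotient_def algebra_simps)
    qed
    note d = partial_derivI[OF this]
    show ?case using Suc by (auto simp: d b continuous_axis_quotient)
  }
qed

lemma smooth_bdd_axis_avg: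
  assumes "0 < h" and "smooth_bdd k B f"
  shows "smooth_bdd k B (axis_avg i h f)"
  using assms(2)
proof (induction k arbitrary: B f)
  case 0
  then show ?case using assms(1) by (auto intro!: continuous_axis_avg abs_axis_avg_le)
next
  case (Suc k)
  have df: "\<And>x. (\<lambda>t. f (x + t *\<^sub>R axis j 1)) differentiable at 0"
    "continuous_on UNIV (partial_deriv j f)" for j
    using Suc.prems smooth_bddD(1)[of k "\<lambda>m. B (Suc m)" "partial_deriv j f"] by auto
  show ?case using Suc assms(1) partial_deriv_axis_avg_commute[OF df(1) _ df(2)]
    by (auto intro!: continuous_axis_avg abs_axis_avg_le)
qed

abbreviation box_avg :: "'d::finite list \<Rightarrow> real \<Rightarrow> (real^'d \<Rightarrow> real) \<Rightarrow> real^'d \<Rightarrow> real" where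
  "box_avg cs h \<equiv> foldr (\<lambda>i. axis_avg i h) cs"

lemma smooth_bdd_box_avg:
  assumes "0 < h" "smooth_bdd k B f"
  shows "smooth_bdd k B (box_avg cs h f)"
  by (induction cs) (auto intro: smooth_bdd_axis_avg assms)

lemma partial_deriv_box_avg_commute:
  fixes f :: "real^'d::finite \<Rightarrow> real"
  assumes diff: "\<And>x. (\<lambda>t. f (x + t *\<^sub>R axis j 1)) differentiable at 0"
    and f: "continuous_on UNIV f" and df: "continuous_on UNIV (partial_deriv j f)"
  shows "(\<lambda>t. box_avg cs h f (x + t *\<^sub>R axis j 1)) differentiable at 0"
    and "partial_deriv j (box_avg cs h f) = box_avg cs h (partial_deriv j f)"
proof -
  have c: "continuous_on UNIV (box_avg cs h g)" if "continuous_on UNIV g" for g and cs :: "'d list"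
    by (induction cs) (auto intro: continuous_axis_avg that)
  have "(\<forall>x. (\<lambda>t. box_avg cs h f (x + t *\<^sub>R axis j 1)) differentiable at 0) \<and>
    partial_deriv j (box_avg cs h f) = box_avg cs h (partial_deriv j f)"
  proof (induction cs)
    case Nil
    then show ?case using diff by simp
  next
    case (Cons i js)
    have "continuous_on UNIV (partial_deriv j (box_avg js h f))"
      using Cons.IH c[OF df] by simp
    with partial_deriv_axis_avg_commute[of "box_avg js h f" j i h] Cons.IH c[OF f]
    show ?case by simp
  qed
  then show "(\<lambda>t. box_avg cs h f (x + t *\<^sub>R axis j 1)) differentiable at 0"
    and "partial_deriv j (box_avg cs h f) = box_avg cs h (partial_deriv j f)" by blast+
qed

text \<open>Among the averages that make up \<open>box_avg\<close>, the one along the axis \<open>j\<close> turns the derivative in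
  direction \<open>j\<close> into a difference quotient, and the others commute with it. So any property \<open>R\<close>
  that difference quotients have and averages keep passes to the derivative. The two instances
  needed are bounds by \<open>1 / h\<close> for smooth functions and bounds by the Lipschitz constant.\<close>
lemma partial_deriv_box_avg:
  fixes Q R :: "(real^'d::finite \<Rightarrow> real) \<Rightarrow> bool"
  assumes h: "0 < h" and j: "j \<in> set cs" and f: "Q f"
    and Q: "\<And>i f. Q f \<Longrightarrow> Q (axis_avg i h f)" "\<And>f. Q f \<Longrightarrow> continuous_on UNIV f"
    and R: "\<And>i f. R f \<Longrightarrow> R (axis_avg i h f)" "\<And>f. R f \<Longrightarrow> continuous_on UNIV f"
    and QR: "\<And>f. Q f \<Longrightarrow> R (axis_quotient j h f)"
  shows "(\<lambda>t. box_avg cs h f (x + t *\<^sub>R axis j 1)) differentiable at 0"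
    and "R (partial_deriv j (box_avg cs h f))"
proof -
  have q: "Q (box_avg cs h f)" for cs
    by (induction cs) (auto intro: Q f)
  have "(\<forall>x. (\<lambda>t. box_avg cs h f (x + t *\<^sub>R axis j 1)) differentiable at 0) \<and>
    R (partial_deriv j (box_avg cs h f))"
    using j
  proof (induction cs)
    case Nil
    then show ?case by simp
  next
    case (Cons i js)
    show ?case
    proof (cases "i = j")
      case True
      then show ?thesis
        using partial_deriv_axis_avg_same[of "box_avg js h f" h j] q[of js] Q h QR by simp
    next
      case False
      with Cons have IH: "\<And>x. (\<lambda>t. box_avg js h f (x + t *\<^sub>R axis j 1)) differentiable at 0"
        "R (partial_deriv j (box_avg js h f))" by auto
      show ?thesis
        using partial_deriv_axis_avg_commute[OF IH(1), of i h] IH(2) Q(2)[OF q[of js]] R by simp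
    qed
  qed
  then show "(\<lambda>t. box_avg cs h f (x + t *\<^sub>R axis j 1)) differentiable at 0"
    and "R (partial_deriv j (box_avg cs h f))" by blast+
qed

text \<open>A difference quotient of width \<open>2 * h\<close> of a function bounded by \<open>B\<close> is at most \<open>B / h\<close>, and the
  list \<open>cs\<close> has to contain every axis for each partial derivative to become one.\<close>
lemma box_avg_gains_derivative:
  fixes f :: "real^'d::finite \<Rightarrow> real"
  assumes h: "0 < h" and cs: "set cs = UNIV" and f: "smooth_bdd k B f"
  shows "smooth_bdd (Suc k) (\<lambda>m. case m of 0 \<Rightarrow> B 0 | Suc m \<Rightarrow> B m / h) (box_avg cs h f)"
proof -
  have "(\<forall>x. (\<lambda>t. box_avg cs h f (x + t *\<^sub>R axis j 1)) differentiable at 0) \<and>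
    smooth_bdd k (\<lambda>m. B m / h) (partial_deriv j (box_avg cs h f))" for j
    using partial_deriv_box_avg[where Q = "smooth_bdd k B" and R = "smooth_bdd k (\<lambda>m. B m / h)"
        and f = f and h = h and j = j and cs = cs]
      smooth_bdd_axis_avg[OF h] smooth_bdd_axis_quotient[OF h] smooth_bddD(1) h cs f
    by blast
  then show ?thesis using smooth_bddD[OF smooth_bdd_box_avg[OF h f]] by auto
qed

lemma funpow_box_avg_smooth:
  assumes h: "0 < h" and cs: "set cs = UNIV" and f: "smooth_bdd 0 (\<lambda>_. L) f"
  shows "smooth_bdd k (\<lambda>m. L / h ^ m) ((box_avg cs h ^^ k) f)"
proof (induction k)
  case 0
  then show ?case using f by simp
next
  case (Suc k)
  have "(\<lambda>m. case m of 0 \<Rightarrow> L / h ^ 0 | Suc m \<Rightarrow> L / h ^ m / h) = (\<lambda>m. L / h ^ m)"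
    by (auto simp: fun_eq_iff split: nat.split)
  then show ?case using box_avg_gains_derivative[OF h cs Suc] by simp
qed

text \<open>The first derivative goes onto \<open>f\<close> itself, so its bound is \<open>L\<close> and not \<open>V / h\<close>; only the
  remaining derivatives are paid for by the averages.\<close>
lemma funpow_box_avg_smooth_Suc:
  fixes f :: "real^'d::finite \<Rightarrow> real"
  assumes h: "0 < h" and cs: "set cs = UNIV" and f: "smooth_bdd 1 (\<lambda>m. case m of 0 \<Rightarrow> V | Suc _ \<Rightarrow> L) f"
  shows "smooth_bdd (Suc k) (\<lambda>m. case m of 0 \<Rightarrow> V | Suc m \<Rightarrow> L / h ^ m) ((box_avg cs h ^^ k) f)"
proof -
  have *: "(\<forall>x. (\<lambda>t. (box_avg cs h ^^ k) f (x + t *\<^sub>R axis j 1)) differentiable at 0) \<and>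
    partial_deriv j ((box_avg cs h ^^ k) f) = (box_avg cs h ^^ k) (partial_deriv j f) \<and>
    smooth_bdd 0 (\<lambda>_. V) ((box_avg cs h ^^ k) f) \<and>
    continuous_on UNIV ((box_avg cs h ^^ k) (partial_deriv j f))" for j
  proof (induction k)
    case 0
    then show ?case using f by auto
  next
    case (Suc k)
    have "smooth_bdd 0 (\<lambda>_. L) (partial_deriv j f)" using f by simp
    from smooth_bddD(1)[OF funpow_box_avg_smooth[OF h cs this]]
    have c: "continuous_on UNIV ((box_avg cs h ^^ k) (partial_deriv j f))" for k .
    show ?case
      using partial_deriv_box_avg_commute[of "(box_avg cs h ^^ k) f" j h cs] Suc
        smooth_bdd_box_avg[OF h, of 0 "\<lambda>_. V" "(box_avg cs h ^^ k) f"] c[of "Suc k"]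
      by simp
  qed
  have "smooth_bdd k (\<lambda>m. L / h ^ m) ((box_avg cs h ^^ k) (partial_deriv j f))" for j
    by (rule funpow_box_avg_smooth[OF h cs]) (use f in simp)
  with * show ?thesis by auto
qed

section \<open>Smoothing Lipschitz functions\<close>

definition axis_lipschitz :: "real \<Rightarrow> (real^'d::finite \<Rightarrow> real) \<Rightarrow> bool" where
  "axis_lipschitz L f \<longleftrightarrow> (\<forall>x i s. \<bar>f (x + s *\<^sub>R axis i 1) - f x\<bar> \<le> L * \<bar>s\<bar>)"

lemma axis_lipschitz_axis_avg:
  fixes f :: "real^'d::finite \<Rightarrow> real"
  assumes h: "0 < h" and f: "continuous_on UNIV f" and L: "axis_lipschitz L f"
  shows "axis_lipschitz L (axis_avg i h f)"
  unfolding axis_lipschitz_def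
proof (intro allI)
  fix x j s
  let ?v = "s *\<^sub>R axis j 1 :: real^'d"
  have c: "continuous_on UNIV (\<lambda>x. f (x + ?v))"
    by (intro continuous_on_axis_line[OF f] continuous_intros)
  have "axis_avg i h f (x + ?v) - axis_avg i h f x = axis_avg i h (\<lambda>x. f (x + ?v) - f x) x"
    by (simp add: axis_avg_diff[OF c f] axis_avg_shift)
  also have "\<bar>\<dots>\<bar> \<le> L * \<bar>s\<bar>"
    by (rule abs_axis_avg_le) (use L h in \<open>auto simp: axis_lipschitz_def intro!: continuous_intros c f\<close>)
  finally show "\<bar>axis_avg i h f (x + ?v) - axis_avg i h f x\<bar> \<le> L * \<bar>s\<bar>" .
qed

text \<open>Difference quotients of a Lipschitz function are bounded by its Lipschitz constant, whatever
  the half-width \<open>h\<close>. The first smoothing step can therefore use an arbitrarily small cube.\<close>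
lemma box_avg_lipschitz_smooth:
  fixes f :: "real^'d::finite \<Rightarrow> real"
  assumes h: "0 < h" and cs: "set cs = UNIV" and f: "continuous_on UNIV f"
    and bd: "\<And>x. \<bar>f x\<bar> \<le> V" and L: "axis_lipschitz L f"
  shows "smooth_bdd 1 (\<lambda>m. case m of 0 \<Rightarrow> V | Suc _ \<Rightarrow> L) (box_avg cs h f)"
proof -
  let ?Q = "\<lambda>f::real^'d \<Rightarrow> real. continuous_on UNIV f \<and> axis_lipschitz L f"
  let ?R = "smooth_bdd 0 (\<lambda>_. L) :: (real^'d \<Rightarrow> real) \<Rightarrow> bool"
  have QR: "?R (axis_quotient j h f)" if "?Q f" for f j
  proof -
    have "continuous_on UNIV (axis_quotient j h f)"
      using that by (intro continuous_axis_quotient) auto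
    moreover have "\<bar>axis_quotient j h f x\<bar> \<le> L" for x
    proof -
      have "\<bar>f ((x - h *\<^sub>R axis j 1) + (2 * h) *\<^sub>R axis j 1) - f (x - h *\<^sub>R axis j 1)\<bar> \<le> L * \<bar>2 * h\<bar>"
        using that unfolding axis_lipschitz_def by blast
      moreover have "(x - h *\<^sub>R axis j 1) + (2 * h) *\<^sub>R axis j 1 = x + h *\<^sub>R axis j 1"
        by (simp add: scaleR_2 vec_eq_iff algebra_simps)
      ultimately show ?thesis using h
        by (simp only:) (simp add: axis_quotient_def pos_divide_le_eq)
    qed
    ultimately show ?thesis by simp
  qed
  have "(\<forall>x. (\<lambda>t. box_avg cs h f (x + t *\<^sub>R axis j 1)) differentiable at 0) \<and>
    ?R (partial_deriv j (box_avg cs h f))" for j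
    using partial_deriv_box_avg[where Q = ?Q and R = ?R and f = f and h = h and j = j and cs = cs]
      continuous_axis_avg axis_lipschitz_axis_avg[OF h] smooth_bdd_axis_avg[OF h] QR
      smooth_bddD(1) h cs f L
    by blast
  moreover have "smooth_bdd 0 (\<lambda>_. V) (box_avg cs h f)"
    by (rule smooth_bdd_box_avg[OF h]) (use f bd in simp)
  ultimately show ?thesis by simp
qed

section \<open>The periodic \<open>\<ell>\<^sub>1\<close> distance\<close>

definition dist_int :: "real \<Rightarrow> real" where
  "dist_int t = \<bar>t - of_int (round t)\<bar>"

lemma dist_int_le: "dist_int t \<le> \<bar>t - of_int m\<bar>"
  unfolding dist_int_def by (rule round_diff_minimal)

lemma dist_int_triangle: "dist_int (s + t) \<le> dist_int s + \<bar>t\<bar>"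
  using dist_int_le[of "s + t" "round s"] by (simp add: dist_int_def)

lemma dist_int_add_Ints:
  assumes "m \<in> \<int>"
  shows "dist_int (t + m) = dist_int t"
proof -
  obtain k where k: "m = of_int k" using assms by (auto elim: Ints_cases)
  have "dist_int (t + m) \<le> dist_int t"
    using dist_int_le[of "t + m" "round t + k"] by (simp add: k dist_int_def)
  moreover have "dist_int t \<le> dist_int (t + m)"
    using dist_int_le[of t "round (t + m) - k"] by (simp add: k dist_int_def algebra_simps)
  ultimately show ?thesis by simp
qed

lemma continuous_on_dist_int [continuous_intros]:
  assumes "continuous_on S f"
  shows "continuous_on S (\<lambda>x. dist_int (f x))"
proof -
  have "\<bar>dist_int s - dist_int t\<bar> \<le> \<bar>s - t\<bar>" for s t
    using dist_int_triangle[of s "t - s"] dist_int_triangle[of t "s - t"] by simp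
  then have "1-lipschitz_on UNIV dist_int"
    by (intro lipschitz_onI) (auto simp: dist_real_def)
  then show ?thesis
    using continuous_on_compose2[OF lipschitz_on_continuous_on assms] by blast
qed

text \<open>By periodicity the interval may be shifted to start at an integer. There the distance to the
  nearest integer is one of \<open>t\<close> and \<open>1 - t\<close> or more, so the integrand is at most the sum of two
  explicit exponentials.\<close>
lemma integral_exp_dist_int:
  assumes l: "0 < l"
  shows "integral {0..1} (\<lambda>t. exp (- l * dist_int (t + a))) \<le> 2 / l"
proof -
  define E where "E t = exp (- l * dist_int t)" for t
  have E: "E integrable_on {u..v}" for u v
    unfolding E_def by (intro integrable_continuous_real continuous_intros)
  have per: "integral {u + of_int m..v + of_int m} E = integral {u..v} E" for u v and m :: int
  proof -
    have "E \<circ> (+) (of_int m) = E"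
      by (simp add: fun_eq_iff E_def dist_int_add_Ints add.commute[of "of_int m"])
    then show ?thesis using integral_shift_Icc_real[of u v E "of_int m"] by simp
  qed
  define k where "k = \<lceil>a\<rceil>"
  have k: "a \<le> of_int k" "of_int k \<le> a + 1" unfolding k_def by linarith+
  have "integral {0..1} (\<lambda>t. E (t + a)) = integral {a..a + 1} E"
    using integral_shift_Icc_real[of 0 1 E a] by (simp add: o_def add.commute)
  also have "\<dots> = integral {a..of_int k} E + integral {of_int k..a + 1} E"
    by (rule Henstock_Kurzweil_Integration.integral_combine[symmetric]) (use k E in auto)
  also have "integral {a..of_int k} E = integral {a + 1..of_int k + 1} E"
    using per[of a 1 "of_int k"] by simp
  also have "integral {a + 1..of_int k + 1} E + integral {of_int k..a + 1} E
      = integral {of_int k..of_int k + 1} E"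
    using Henstock_Kurzweil_Integration.integral_combine[of "of_int k" "a + 1" "of_int k + 1" E] k E
    by simp
  also have "\<dots> = integral {0..1} E"
    using per[of 0 k 1] by (simp add: add.commute)
  also have "\<dots> \<le> integral {0..1} (\<lambda>t. exp (- l * t) + exp (l * t - l))"
  proof (rule integral_le)
    fix t :: real assume t: "t \<in> {0..1}"
    have "dist_int t \<ge> t \<or> dist_int t \<ge> 1 - t"
    proof (cases "round t \<le> 0")
      case True
      then have "real_of_int (round t) \<le> 0" by simp
      then show ?thesis unfolding dist_int_def by linarith
    next
      case False
      then have "real_of_int (round t) \<ge> 1" by simp
      then show ?thesis unfolding dist_int_def by linarith
    qed
    then have "E t \<le> exp (- l * t) \<or> E t \<le> exp (l * t - l)"
      using l mult_left_mono[of t "dist_int t" l] mult_left_mono[of "1 - t" "dist_int t" l]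
      by (auto simp: E_def algebra_simps)
    then show "E t \<le> exp (- l * t) + exp (l * t - l)"
      by (auto intro: add_increasing add_increasing2)
  qed (auto intro!: E integrable_continuous_real continuous_intros)
  also have "integral {0..1} (\<lambda>t. exp (- l * t) + exp (l * t - l)) = 2 * (1 - exp (- l)) / l"
  proof -
    have "((\<lambda>t. exp (- l * t) + exp (l * t - l)) has_integral
        (- exp (- l * 1) + exp (l * 1 - l)) / l - (- exp (- l * 0) + exp (l * 0 - l)) / l) {0..1}"
      by (rule fundamental_theorem_of_calculus)
         (use l in \<open>auto intro!: derivative_eq_intros
            simp flip: has_real_derivative_iff_has_vector_derivative, auto simp: field_simps\<close>)
    then show ?thesis using l by (simp add: integral_unique field_simps)
  qed
  also have "\<dots> \<le> 2 / l" using l by (simp add: field_simps)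
  finally show ?thesis by (simp add: E_def)
qed

definition torus_dist :: "'a::euclidean_space \<Rightarrow> 'a \<Rightarrow> real" where
  "torus_dist x p = (\<Sum>b\<in>Basis. dist_int ((x - p) \<bullet> b))"

lemma torus_dist_triangle:
  assumes "b \<in> Basis"
  shows "torus_dist (x + t *\<^sub>R b) p \<le> torus_dist x p + \<bar>t\<bar>"
proof -
  have "torus_dist (x + t *\<^sub>R b) p
      \<le> (\<Sum>c\<in>Basis. dist_int ((x - p) \<bullet> c) + (if c = b then \<bar>t\<bar> else 0))"
    unfolding torus_dist_def
  proof (rule sum_mono)
    fix c :: 'a assume c: "c \<in> Basis"
    have "(x + t *\<^sub>R b - p) \<bullet> c = (x - p) \<bullet> c + (if c = b then t else 0)"
      using c assms by (auto simp: inner_diff_left inner_add_left inner_Basis)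
    then show "dist_int ((x + t *\<^sub>R b - p) \<bullet> c)
        \<le> dist_int ((x - p) \<bullet> c) + (if c = b then \<bar>t\<bar> else 0)"
      using dist_int_triangle[of "(x - p) \<bullet> c" t] by (cases "c = b") simp_all
  qed
  also have "\<dots> = torus_dist x p + \<bar>t\<bar>"
    using assms by (simp add: sum.distrib torus_dist_def)
  finally show ?thesis .
qed

lemma torus_dist_add_lattice:
  assumes "\<And>b. b \<in> Basis \<Longrightarrow> v \<bullet> b \<in> \<int>"
  shows "torus_dist (x + v) p = torus_dist x p"
  unfolding torus_dist_def
proof (rule sum.cong)
  fix b :: 'a assume "b \<in> Basis"
  then show "dist_int ((x + v - p) \<bullet> b) = dist_int ((x - p) \<bullet> b)"
    using dist_int_add_Ints[OF assms, of b "(x - p) \<bullet> b"] by (simp add: inner_simps algebra_simps)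
qed simp

lemma torus_dist_self: "torus_dist p p = 0"
  by (simp add: torus_dist_def dist_int_def)

lemma continuous_on_torus_dist [continuous_intros]:
  "continuous_on S f \<Longrightarrow> continuous_on S (\<lambda>x. torus_dist (f x) p)"
  unfolding torus_dist_def by (intro continuous_intros)

text \<open>The exponential of an \<open>\<ell>\<^sub>1\<close> distance is a product over the coordinates. This bound replaces the
  volume of an \<open>\<ell>\<^sub>1\<close> ball: the ball \<open>torus_dist x p \<le> R\<close> has indicator at most
  \<open>exp (l * (R - torus_dist x p))\<close>, hence volume at most \<open>exp (l * R) * (2 / l) ^ d\<close>, and
  \<open>l = d / R\<close> gives \<open>(2 e R / d) ^ d\<close>.\<close>
lemma integral_exp_torus_dist:
  fixes y p :: "'a::euclidean_space"
  assumes l: "0 < l"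
  shows "integral (cbox 0 One) (\<lambda>x. exp (- l * torus_dist (x + y) p)) \<le> (2 / l) ^ DIM('a)"
proof -
  define I where "I = integral (cbox 0 One) (\<lambda>x. exp (- l * torus_dist (x + y) p))"
  define \<phi> where "\<phi> b t = (if t \<in> {0..1} then exp (- l * dist_int (t + (y - p) \<bullet> b)) else 0)"
    for b :: 'a and t :: real
  have \<phi>_nonneg: "0 \<le> \<phi> b t" for b t by (simp add: \<phi>_def)
  have \<phi>_meas: "\<phi> b \<in> borel_measurable borel" for b
  proof -
    have "(\<lambda>t. exp (- l * dist_int (t + (y - p) \<bullet> b))) \<in> borel_measurable borel"
      by (intro borel_measurable_continuous_onI continuous_intros)
    then show ?thesis unfolding \<phi>_def by measurable
  qed
  define J where "J b = integral {0..1} (\<lambda>t. exp (- l * dist_int (t + (y - p) \<bullet> b)))" for b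
  have J: "0 \<le> J b" "J b \<le> 2 / l" for b
  proof -
    show "0 \<le> J b"
      unfolding J_def by (intro integral_nonneg integrable_continuous_real continuous_intros) simp
    show "J b \<le> 2 / l"
      unfolding J_def by (rule integral_exp_dist_int[OF l])
  qed
  have \<phi>_int: "(\<integral>\<^sup>+t. ennreal (\<phi> b t) \<partial>lborel) = ennreal (J b)" for b
  proof (rule nn_integral_has_integral_lborel[OF \<phi>_meas \<phi>_nonneg])
    have "((\<lambda>t. exp (- l * dist_int (t + (y - p) \<bullet> b))) has_integral J b) {0..1}"
      unfolding J_def by (intro integrable_integral integrable_continuous_real continuous_intros)
    then show "(\<phi> b has_integral J b) UNIV"
      unfolding \<phi>_def by (simp only: has_integral_restrict_UNIV)
  qed
  have prod: "(\<Prod>b\<in>Basis. \<phi> b (x \<bullet> b)) =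
      (if x \<in> cbox 0 One then exp (- l * torus_dist (x + y) p) else 0)" for x
  proof (cases "x \<in> cbox 0 One")
    case True
    then have "(\<Prod>b\<in>Basis. \<phi> b (x \<bullet> b)) = (\<Prod>b\<in>Basis. exp (- l * dist_int ((x + y - p) \<bullet> b)))"
      by (intro prod.cong) (auto simp: \<phi>_def mem_box inner_simps algebra_simps)
    also have "\<dots> = exp (- l * torus_dist (x + y) p)"
      by (simp add: torus_dist_def sum_distrib_left exp_sum flip: sum_negf)
    finally show ?thesis using True by simp
  next
    case False
    then obtain b where "b \<in> Basis" "\<phi> b (x \<bullet> b) = 0"
      by (force simp: mem_box \<phi>_def)
    with False show ?thesis by (simp add: prod_zero_iff) blast
  qed
  have "((\<lambda>x. exp (- l * torus_dist (x + y) p)) has_integral I) (cbox 0 One)"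
    unfolding I_def by (intro integrable_integral integrable_continuous continuous_intros)
  then have "((\<lambda>x. \<Prod>b\<in>Basis. \<phi> b (x \<bullet> b)) has_integral I) UNIV"
    unfolding prod by (simp only: has_integral_restrict_UNIV)
  then have "ennreal I = (\<integral>\<^sup>+x. ennreal (\<Prod>b\<in>Basis. \<phi> b (x \<bullet> b)) \<partial>lborel)"
    by (intro nn_integral_has_integral_lborel[symmetric] borel_measurable_prod prod_nonneg
          measurable_compose[OF _ \<phi>_meas] \<phi>_nonneg) simp_all
  also have "\<dots> = (\<integral>\<^sup>+x. (\<Prod>b\<in>Basis. ennreal (\<phi> b (x \<bullet> b))) \<partial>lborel)"
    by (intro nn_integral_cong prod_ennreal[symmetric] \<phi>_nonneg)
  also have "\<dots> = (\<Prod>b\<in>Basis. (\<integral>\<^sup>+t. ennreal (\<phi> b t) \<partial>lborel))"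
    by (intro nn_integral_lborel_prod) (use \<phi>_meas in auto)
  also have "\<dots> = ennreal (\<Prod>b\<in>Basis. J b)"
    using J by (simp add: \<phi>_int prod_ennreal)
  finally have "ennreal I \<le> ennreal (\<Prod>b\<in>Basis. J b)" by simp
  then have "I \<le> (\<Prod>b\<in>Basis. J b)"
    by (subst (asm) ennreal_le_iff) (simp_all add: prod_nonneg J)
  also have "\<dots> \<le> (\<Prod>b\<in>(Basis :: 'a set). 2 / l)"
    by (intro prod_mono) (use J in auto)
  finally show ?thesis by (simp add: I_def)
qed

definition vanishes_near :: "real \<Rightarrow> 'a::euclidean_space \<Rightarrow> ('a \<Rightarrow> real) \<Rightarrow> bool" where
  "vanishes_near \<rho> p f \<longleftrightarrow> (\<forall>x. torus_dist x p \<le> \<rho> \<longrightarrow> f x = 0)"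

definition lattice_periodic :: "(real^'d::finite \<Rightarrow> real) \<Rightarrow> bool" where
  "lattice_periodic f \<longleftrightarrow> (\<forall>x v. (\<forall>i. v $ i \<in> {0, 1}) \<longrightarrow> f (x + v) = f x)"

text \<open>The function is the minimum of \<open>V\<close> and the ramps \<open>L * max 0 (torus_dist x p - \<rho>)\<close>. The lower
  bound by exponentials rather than indicators of balls reduces its integral to one explicit
  integral for each node; it holds because \<open>V * (1 - exp (l * (R - torus_dist x p)))\<close> is at most
  zero within distance \<open>R\<close> of \<open>p\<close> and at most \<open>V\<close> elsewhere, where the ramp has reached \<open>V\<close>.\<close>
lemma exists_plateau_function:
  fixes P :: "(real^'d::finite) set"
  assumes P: "finite P" and V: "0 < V" and L: "0 < L"
    and l: "0 < l" and R: "R = \<rho> + V / L"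
  shows "\<exists>g. continuous_on UNIV g \<and> (\<forall>x. 0 \<le> g x \<and> g x \<le> V)
    \<and> axis_lipschitz L g \<and> lattice_periodic g \<and> (\<forall>p\<in>P. vanishes_near \<rho> p g)
    \<and> (\<forall>x. V * (1 - (\<Sum>p\<in>P. exp (l * (R - torus_dist x p)))) \<le> g x)"
  using P
  unfolding axis_lipschitz_def lattice_periodic_def vanishes_near_def
proof (induction P)
  case empty
  show ?case using V L by (intro exI[of _ "\<lambda>x. V"]) (auto intro!: continuous_intros)
next
  case (insert p P)
  then obtain g where g: "continuous_on UNIV g" "\<And>x. 0 \<le> g x" "\<And>x. g x \<le> V"
    "\<And>x i s. \<bar>g (x + s *\<^sub>R axis i 1) - g x\<bar> \<le> L * \<bar>s\<bar>"
    "\<And>x v. (\<forall>i. v $ i \<in> {0, 1}) \<Longrightarrow> g (x + v) = g x"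
    "\<And>x q. q \<in> P \<Longrightarrow> torus_dist x q \<le> \<rho> \<Longrightarrow> g x = 0"
    "\<And>x. V * (1 - (\<Sum>p\<in>P. exp (l * (R - torus_dist x p)))) \<le> g x"
    by blast
  define c where "c x = L * max 0 (torus_dist x p - \<rho>)" for x
  have c_lip: "\<bar>c (x + s *\<^sub>R axis i 1) - c x\<bar> \<le> L * \<bar>s\<bar>" for x s i
  proof -
    have b: "axis i (1::real) \<in> Basis" by simp
    have "\<bar>max 0 (torus_dist (x + s *\<^sub>R axis i 1) p - \<rho>) - max 0 (torus_dist x p - \<rho>)\<bar> \<le> \<bar>s\<bar>"
      using torus_dist_triangle[OF b, of x s p]
        torus_dist_triangle[OF b, of "x + s *\<^sub>R axis i 1" "- s" p] by simp
    from mult_left_mono[OF this, of L] show ?thesis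
      using L by (simp add: c_def abs_mult flip: right_diff_distrib)
  qed
  have c_lower: "V * (1 - exp (l * (R - torus_dist x p))) \<le> c x" for x
  proof (cases "torus_dist x p \<le> R")
    case True
    then have "exp (l * (R - torus_dist x p)) \<ge> 1" using l by simp
    then have "V * (1 - exp (l * (R - torus_dist x p))) \<le> 0"
      using V by (simp add: mult_nonneg_nonpos)
    also have "0 \<le> c x" using L by (simp add: c_def)
    finally show ?thesis .
  next
    case False
    have "V * (1 - exp (l * (R - torus_dist x p))) \<le> V" using V by simp
    also have "\<dots> = L * (R - \<rho>)" using L R by simp
    also have "\<dots> \<le> c x" using L False unfolding c_def by simp
    finally show ?thesis .
  qed
  have c_per: "c (x + v) = c x" if "\<forall>i. v $ i \<in> {0, 1}" for x v
  proof -
    have "v \<bullet> b \<in> \<int>" if "b \<in> Basis" for b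
      using that \<open>\<forall>i. v $ i \<in> {0, 1}\<close> Ints_0 Ints_1
      by (auto simp: Basis_vec_def inner_axis) (metis Ints_0 Ints_1)
    then show ?thesis by (simp add: c_def torus_dist_add_lattice)
  qed
  show ?case
  proof (intro exI[of _ "\<lambda>x. min (g x) (c x)"] conjI allI impI ballI)
    show "continuous_on UNIV (\<lambda>x. min (g x) (c x))"
      unfolding c_def by (intro continuous_intros g)
  next
    fix x i s
    show "\<bar>min (g (x + s *\<^sub>R axis i 1)) (c (x + s *\<^sub>R axis i 1)) - min (g x) (c x)\<bar> \<le> L * \<bar>s\<bar>"
      using g(4)[of x s i] c_lip[of x s i] by linarith
  next
    fix q x assume "q \<in> insert p P" and "torus_dist x q \<le> \<rho>"
    then show "min (g x) (c x) = 0"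
      using g(6)[of q x] g(2)[of x] L by (auto simp: c_def)
  next
    fix x
    let ?e = "\<lambda>p::real^'d. exp (l * (R - torus_dist x p))"
    let ?s = "\<Sum>p\<in>P. ?e p"
    have s: "0 \<le> V * ?s" "0 \<le> V * ?e p" using V by (auto intro!: mult_nonneg_nonneg sum_nonneg)
    have "(\<Sum>p\<in>insert p P. ?e p) = ?e p + ?s" using insert by simp
    then show "V * (1 - (\<Sum>p\<in>insert p P. ?e p)) \<le> min (g x) (c x)"
      using g(7)[of x] c_lower[of x] s by (simp add: algebra_simps)
  qed (use g L c_per in \<open>auto simp: c_def min.coboundedI1\<close>)
qed

section \<open>Properties kept by averaging\<close>

lemma vanishes_near_axis_avg:
  fixes f :: "real^'d::finite \<Rightarrow> real"
  assumes f: "vanishes_near (\<rho> + h) p f" and h: "0 < h"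
  shows "vanishes_near \<rho> p (axis_avg i h f)"
  unfolding vanishes_near_def
proof (intro allI impI)
  fix x :: "real^'d" assume x: "torus_dist x p \<le> \<rho>"
  have "f (x + t *\<^sub>R axis i 1) = 0" if "t \<in> {-h..h}" for t
  proof -
    have "torus_dist (x + t *\<^sub>R axis i 1) p \<le> torus_dist x p + \<bar>t\<bar>"
      by (rule torus_dist_triangle) simp
    then show ?thesis using that x f unfolding vanishes_near_def by (smt (verit) atLeastAtMost_iff)
  qed
  then have "integral {-h..h} (\<lambda>t. f (x + t *\<^sub>R axis i 1)) = integral {-h..h} (\<lambda>t. 0)"
    by (rule integral_cong)
  then show "axis_avg i h f x = 0" by (simp add: axis_avg_def)
qed

lemma vanishes_near_box_avg:
  fixes \<rho> h :: real
  assumes "vanishes_near (\<rho> + length cs * h) p f" and h: "0 < h"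
  shows "vanishes_near \<rho> p (box_avg cs h f)"
  using assms(1)
proof (induction cs arbitrary: \<rho>)
  case (Cons i cs)
  then show ?case using h by (auto intro!: vanishes_near_axis_avg simp: algebra_simps)
qed simp

lemma vanishes_near_funpow_box_avg:
  fixes \<rho> h :: real
  assumes "vanishes_near (\<rho> + k * (length cs * h)) p f" and h: "0 < h"
  shows "vanishes_near \<rho> p ((box_avg cs h ^^ k) f)"
  using assms(1)
proof (induction k arbitrary: \<rho>)
  case (Suc k)
  then show ?case using h by (auto intro!: vanishes_near_box_avg simp: algebra_simps)
qed simp

text \<open>The integral of an average over the unit cube is an average of integrals over translates of the
  cube, so the bound is asked for all translates at once; it then passes to averages by Fubini.\<close>
definition shifted_integral_ge :: "real \<Rightarrow> (real^'d::finite \<Rightarrow> real) \<Rightarrow> bool" where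
  "shifted_integral_ge c f \<longleftrightarrow> continuous_on UNIV f \<and> (\<forall>y. c \<le> integral (cbox 0 1) (\<lambda>x. f (x + y)))"

lemma shifted_integral_ge_axis_avg:
  fixes f :: "real^'d::finite \<Rightarrow> real"
  assumes f: "shifted_integral_ge c f" and h: "0 < h"
  shows "shifted_integral_ge c (axis_avg i h f)"
proof -
  have cont: "continuous_on UNIV f" using f by (simp add: shifted_integral_ge_def)
  have "c \<le> integral (cbox 0 1) (\<lambda>x. axis_avg i h f (x + y))" for y
  proof -
    let ?F = "\<lambda>(x::real^'d) t. f (x + (y + t *\<^sub>R axis i 1))"
    have sw: "integral (cbox 0 1) (\<lambda>x. integral (cbox (-h) h) (?F x))
        = integral (cbox (-h) h) (\<lambda>t. integral (cbox 0 1) (\<lambda>x. ?F x t))"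
      by (rule integral_swap_continuous)
         (auto simp: case_prod_unfold intro!: continuous_on_compose2[OF cont] continuous_intros)
    have "(2 * h) * c = integral {-h..h} (\<lambda>t. c)" using h by simp
    also have "\<dots> \<le> integral {-h..h} (\<lambda>t. integral (cbox 0 1) (\<lambda>x. ?F x t))"
    proof (rule integral_le)
      show "(\<lambda>t. integral (cbox 0 1) (\<lambda>x. ?F x t)) integrable_on {-h..h}"
        by (intro integrable_continuous_real integral_continuous_on_param)
           (auto simp: case_prod_unfold intro!: continuous_on_compose2[OF cont] continuous_intros)
    qed (use f in \<open>auto simp: shifted_integral_ge_def\<close>)
    also have "\<dots> = integral (cbox 0 1) (\<lambda>x. integral {-h..h} (?F x))"
      using sw by simp
    also have "\<dots> = (2 * h) * integral (cbox 0 1) (\<lambda>x. axis_avg i h f (x + y))"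
      using h by (simp add: axis_avg_def add.assoc)
    finally show ?thesis using h by simp
  qed
  then show ?thesis using continuous_axis_avg[OF cont] by (simp add: shifted_integral_ge_def)
qed

lemma lattice_periodic_axis_avg: "lattice_periodic f \<Longrightarrow> lattice_periodic (axis_avg i h f)"
  unfolding lattice_periodic_def axis_avg_shift by (simp add: axis_avg_def add.assoc)

lemma box_avg_invariant:
  assumes "\<And>i f. Q f \<Longrightarrow> Q (axis_avg i h f)" "Q f"
  shows "Q (box_avg cs h f)" "Q ((box_avg cs h ^^ k) f)"
proof -
  have *: "Q (box_avg cs h g)" if "Q g" for g
    using that by (induction cs) (auto intro: assms)
  then show "Q (box_avg cs h f)" using assms by blast
  show "Q ((box_avg cs h ^^ k) f)" by (induction k) (use * assms in auto)
qed

lemma One_eq_one: "(One :: real^'d::finite) = 1"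
proof (rule euclidean_eqI)
  fix b :: "real^'d" assume b: "b \<in> Basis"
  then have "1 \<bullet> b = 1" by (auto simp: Basis_vec_def inner_axis)
  with b show "One \<bullet> b = 1 \<bullet> b" by simp
qed

lemma content_unit_cbox: "measure lborel (cbox 0 (1 :: real^'d::finite)) = 1"
  using content_unit[where 'a = "real^'d"] by (simp only: One_eq_one)

section \<open>Fooling functions\<close>

text \<open>The smoothed plateau. Its lattice periodicity, its zeros and its integral come from the
  invariance of these properties under averaging; the bounds on its derivatives come from
  \<open>funpow_box_avg_smooth_Suc\<close>.\<close>
lemma exists_fooling_function:
  fixes P :: "(real^'d::finite) set"
  assumes P: "finite P" and r: "1 \<le> r" and h: "0 < h" and \<eta>: "0 < \<eta>"
    and small: "real CARD('d) * h ^ r \<le> 1"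
  shows "\<exists>f. f \<in> C_per r \<and> (\<lambda>x. - f x) \<in> C_per r \<and> (\<forall>p\<in>P. f p = 0) \<and>
    real CARD('d) * h ^ r * (1 - card P * (2 * exp 1 * (r * h + \<eta>)) ^ CARD('d)) \<le> S_int f"
proof -
  let ?d = "real CARD('d)"
  \<comment> \<open>\<open>\<rho>\<close> is what the averages take away from the radius of vanishing, \<open>R\<close> is the distance from
    the nodes at which the plateau is reached, and \<open>l = d / R\<close> is the optimal rate in the
    exponential bound for the volume of the balls.\<close>
  define V where "V = ?d * h ^ r"
  define L where "L = h ^ (r - 1)"
  define \<rho> where "\<rho> = (r - 1) * (?d * h) + ?d * \<eta>"
  define R where "R = ?d * (r * h + \<eta>)"
  define l where "l = 1 / (r * h + \<eta>)"
  have pos: "0 < V" "0 < L" "0 < r * h + \<eta>" "0 < l"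
    using h \<eta> by (auto simp: V_def L_def l_def add_nonneg_pos)
  have hr: "h ^ r = h * h ^ (r - 1)" using r by (cases r) auto
  have VL: "V / L = ?d * h" using h by (simp add: V_def L_def hr)
  have R: "R = \<rho> + V / L" unfolding VL R_def \<rho>_def using r by (simp add: of_nat_diff algebra_simps)
  obtain g :: "real^'d \<Rightarrow> real" where g: "continuous_on UNIV g" "\<And>x. 0 \<le> g x" "\<And>x. g x \<le> V"
    "axis_lipschitz L g" "lattice_periodic g" "\<And>p. p \<in> P \<Longrightarrow> vanishes_near \<rho> p g"
    "\<And>x. V * (1 - (\<Sum>p\<in>P. exp (l * (R - torus_dist x p)))) \<le> g x"
    using exists_plateau_function[OF P pos(1,2,4) R] by blast
  obtain cs :: "'d list" where cs: "set cs = UNIV" "length cs = CARD('d)"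
    using finite_distinct_list[of "UNIV :: 'd set"] distinct_card by fastforce
  define G where "G = box_avg cs \<eta> g"
  define f where "f = (box_avg cs h ^^ (r - 1)) G"
  have "smooth_bdd 1 (\<lambda>m. case m of 0 \<Rightarrow> V | Suc _ \<Rightarrow> L) G"
    unfolding G_def
    by (rule box_avg_lipschitz_smooth[OF \<eta> cs(1) g(1)]) (use g in auto)
  from funpow_box_avg_smooth_Suc[OF h cs(1) this, of "r - 1"] r
  have f_smooth: "smooth_bdd r (\<lambda>m. case m of 0 \<Rightarrow> V | Suc m \<Rightarrow> L / h ^ m) f"
    by (simp add: f_def)
  have "h ^ r \<le> ?d * h ^ r" using h by (simp add: mult_le_cancel_right1 Suc_le_eq)
  then have "h ^ r \<le> 1" using small by linarith
  then have h1: "h \<le> 1" using h r by (simp add: power_le_one_iff)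
  have bound: "(case m of 0 \<Rightarrow> V | Suc m \<Rightarrow> L / h ^ m) \<le> 1" if "m \<le> r" for m
  proof (cases m)
    case (Suc k)
    then have "h ^ (r - 1) \<le> h ^ k" using h h1 that by (intro power_decreasing) auto
    then show ?thesis using Suc h by (simp add: L_def)
  qed (use small in \<open>simp add: V_def\<close>)
  have "lattice_periodic f"
    unfolding f_def G_def
    using box_avg_invariant[where Q = lattice_periodic] lattice_periodic_axis_avg
      g(5) by metis
  then have per: "f (x + v) = f x" if "\<And>i. v $ i \<in> {0, 1}" for x v
    using that by (auto simp: lattice_periodic_def)
  have C: "f \<in> C_per r" by (rule smooth_bdd_imp_C_per[OF f_smooth bound per])
  have C': "(\<lambda>x. - f x) \<in> C_per r"
    by (rule smooth_bdd_imp_C_per[OF smooth_bdd_uminus[OF f_smooth] bound]) (simp_all add: per)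
  have "f p = 0" if "p \<in> P" for p
  proof -
    from g(6)[OF that] have "vanishes_near 0 p f"
      unfolding f_def G_def
      using r
      by (intro vanishes_near_funpow_box_avg[OF _ h] vanishes_near_box_avg[OF _ \<eta>])
         (simp add: \<rho>_def cs of_nat_diff algebra_simps)
    then show ?thesis by (simp add: vanishes_near_def torus_dist_self)
  qed
  moreover have "V * (1 - card P * (2 * exp 1 * (r * h + \<eta>)) ^ CARD('d)) \<le> S_int f"
  proof -
    let ?c = "V * (1 - card P * (2 * exp 1 * (r * h + \<eta>)) ^ CARD('d))"
    have "?c \<le> integral (cbox 0 1) (\<lambda>x. g (x + y))" for y
    proof -
      let ?E = "\<lambda>x p. exp (- l * torus_dist (x + y) p)"
      have cE: "(\<lambda>x. ?E x p) integrable_on cbox 0 1" for p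
        by (intro integrable_continuous continuous_intros)
      have lR: "l * R = ?d" unfolding l_def R_def using pos(3) by simp
      have eE: "exp (l * (R - torus_dist (x + y) p)) = exp ?d * ?E x p" for x p
        by (simp add: right_diff_distrib lR flip: exp_add)
      have "(\<Sum>p\<in>P. exp ?d * integral (cbox 0 1) (\<lambda>x. ?E x p))
          \<le> (\<Sum>p\<in>P. exp ?d * (2 / l) ^ CARD('d))"
        by (intro sum_mono mult_left_mono)
           (use integral_exp_torus_dist[OF pos(4), of y] in \<open>auto simp: One_eq_one\<close>)
      also have "\<dots> = card P * (2 * exp 1 * (r * h + \<eta>)) ^ CARD('d)"
      proof -
        have "exp ?d = exp 1 ^ CARD('d)" by (simp flip: exp_of_nat_mult)
        moreover have "2 / l = 2 * (r * h + \<eta>)" by (simp add: l_def)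
        ultimately show ?thesis by (simp add: power_mult_distrib del: distrib_left_numeral)
      qed
      finally have "?c \<le> V * (1 - (\<Sum>p\<in>P. exp ?d * integral (cbox 0 1) (\<lambda>x. ?E x p)))"
        by (intro mult_left_mono diff_left_mono) (use pos(1) in simp_all)
      also have "\<dots> = integral (cbox 0 1) (\<lambda>x. V * (1 - (\<Sum>p\<in>P. exp ?d * ?E x p)))"
      proof -
        have "((\<lambda>x. V * (1 - (\<Sum>p\<in>P. exp ?d * ?E x p))) has_integral
            V * (1 - (\<Sum>p\<in>P. exp ?d * integral (cbox 0 1) (\<lambda>x. ?E x p)))) (cbox 0 1)"
          using has_integral_const[of "1::real" 0 "1 :: real^'d"]
          by (intro has_integral_mult_right has_integral_diff has_integral_sum P
                integrable_integral cE) (simp add: content_unit_cbox)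
        then show ?thesis by (rule integral_unique[symmetric])
      qed
      also have "\<dots> \<le> integral (cbox 0 1) (\<lambda>x. g (x + y))"
      proof (rule integral_le)
        show "(\<lambda>x. V * (1 - (\<Sum>p\<in>P. exp ?d * ?E x p))) integrable_on cbox 0 1"
          by (intro integrable_continuous continuous_intros)
        show "(\<lambda>x. g (x + y)) integrable_on cbox 0 1"
          by (intro integrable_continuous continuous_on_compose2[OF g(1)] continuous_intros) auto
        show "V * (1 - (\<Sum>p\<in>P. exp ?d * ?E x p)) \<le> g (x + y)" for x
          using g(7)[of "x + y"] by (simp only: eE)
      qed
      finally show ?thesis .
    qed
    with g(1) have "shifted_integral_ge ?c g" by (simp add: shifted_integral_ge_def)
    then have "shifted_integral_ge ?c f"
      unfolding f_def G_def
      using box_avg_invariant[where Q = "shifted_integral_ge ?c"]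
        shifted_integral_ge_axis_avg h \<eta> by metis
    then have "?c \<le> integral (cbox 0 1) (\<lambda>x. f (x + 0))"
      unfolding shifted_integral_ge_def by blast
    then show ?thesis by (simp add: S_int_def)
  qed
  ultimately show ?thesis using C C' unfolding V_def by blast
qed

section \<open>Worst case errors\<close>

lemma info_cong:
  assumes "\<And>k. k < n \<Longrightarrow> f (\<psi> (info \<psi> k g)) = g (\<psi> (info \<psi> k g))"
  shows "info \<psi> n f = info \<psi> n g"
  using assms by (induction n) auto

text \<open>Sampling points may depend on earlier values, but a function that vanishes at all points
  visited for the zero function is never told apart from the zero function. Both \<open>f\<close> and \<open>-f\<close>
  are then mapped to the same number \<open>a\<close>, and one of \<open>S_int f\<close> and \<open>- S_int f\<close> is at distance at
  least \<open>S_int f\<close> from \<open>a\<close>.\<close>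
lemma minimal_error_lower_bound:
  fixes F :: "(real^'d::finite \<Rightarrow> real) set"
  assumes F: "\<And>P. finite P \<Longrightarrow> card P \<le> n \<Longrightarrow>
      \<exists>f\<in>F. (\<lambda>x. - f x) \<in> F \<and> (\<forall>p\<in>P. f p = 0) \<and> c \<le> S_int f"
  shows "ereal c \<le> minimal_error n F"
  unfolding minimal_error_def
proof (rule INF_greatest)
  fix A assume "A \<in> algorithms n F"
  then obtain \<phi> \<psi> where A: "\<And>f. f \<in> F \<Longrightarrow> A f = \<phi> (info \<psi> n f)"
    by (auto simp: algorithms_def)
  define P where "P = (\<lambda>k. \<psi> (info \<psi> k (\<lambda>_. 0))) ` {..<n}"
  have "finite P" "card P \<le> n"
    unfolding P_def using card_image_le[of "{..<n}"] by auto
  then obtain f where f: "f \<in> F" "(\<lambda>x. - f x) \<in> F" "\<And>p. p \<in> P \<Longrightarrow> f p = 0" "c \<le> S_int f"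
    using F by blast
  have "info \<psi> n f = info \<psi> n (\<lambda>_. 0)" "info \<psi> n (\<lambda>x. - f x) = info \<psi> n (\<lambda>_. 0)"
    using f(3) by (auto intro!: info_cong simp: P_def)
  with A f(1,2) have "A f = A (\<lambda>x. - f x)" by simp
  moreover have "S_int (\<lambda>x. - f x) = - S_int f" by (simp add: S_int_def)
  ultimately have "c \<le> \<bar>S_int f - A f\<bar> \<or> c \<le> \<bar>S_int (\<lambda>x. - f x) - A (\<lambda>x. - f x)\<bar>"
    using f(4) by linarith
  then obtain f' where "f' \<in> F" "c \<le> \<bar>S_int f' - A f'\<bar>" using f by blast
  then show "ereal c \<le> wc_error F A"
    unfolding wc_error_def by (intro SUP_upper2[of f']) auto
qed

lemma C_per_partial_deriv:
  fixes f :: "real^'d::finite \<Rightarrow> real"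
  assumes r: "1 \<le> r" and f: "f \<in> C_per r"
  shows "continuous_on UNIV f" "(\<lambda>t. f (x + t *\<^sub>R axis i 1)) differentiable at 0"
    "\<bar>partial_deriv i f x\<bar> \<le> 1"
proof -
  obtain k where k: "r = Suc k" using r by (cases r) auto
  show "continuous_on UNIV f" "(\<lambda>t. f (x + t *\<^sub>R axis i 1)) differentiable at 0"
    using f by (auto simp: C_per_def k)
  define \<beta> :: "'d \<Rightarrow> nat" where "\<beta> = (\<lambda>j. if j = i then 1 else 0)"
  have sum: "(\<Sum>j\<in>UNIV. \<beta> j) = 1" by (simp add: \<beta>_def)
  obtain js where js: "mixed_partial \<beta> = foldr partial_deriv js" "\<And>j. count_list js j = \<beta> j"
    "length js = 1" using mixed_partial_eq_foldr[of \<beta>] sum by metis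
  then obtain j where j: "js = [j]" by (auto simp: length_Suc_conv)
  with js(2)[of i] have "j = i" by (auto simp: \<beta>_def split: if_splits)
  then have "mixed_partial \<beta> f = partial_deriv i f" using js j by simp
  moreover have "(SUP x. ereal \<bar>mixed_partial \<beta> f x\<bar>) \<le> 1"
  proof -
    have "(\<Sum>j\<in>UNIV. \<beta> j) \<le> r" using sum r by simp
    then show ?thesis using f unfolding C_per_def by blast
  qed
  ultimately have "(SUP x. ereal \<bar>partial_deriv i f x\<bar>) \<le> 1" by simp
  then have "ereal \<bar>partial_deriv i f x\<bar> \<le> 1"
    by (rule order_trans[OF SUP_upper[of x UNIV], rotated]) simp
  then show "\<bar>partial_deriv i f x\<bar> \<le> 1" by simp
qed

text \<open>The mean value theorem along the axes, one coordinate after the other.\<close>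
lemma C_per_lipschitz:
  fixes f :: "real^'d::finite \<Rightarrow> real"
  assumes r: "1 \<le> r" and f: "f \<in> C_per r"
  shows "\<bar>f x - f y\<bar> \<le> real CARD('d) * norm (x - y)"
proof -
  have step: "\<bar>f (x + s *\<^sub>R axis i 1) - f x\<bar> \<le> \<bar>s\<bar>" for x s i
  proof -
    have "norm (f (x + s *\<^sub>R axis i 1) - f (x + 0 *\<^sub>R axis i 1)) \<le> 1 * norm (s - 0)"
      by (rule field_differentiable_bound[where S = UNIV and f' = "\<lambda>t. partial_deriv i f (x + t *\<^sub>R axis i 1)"])
         (use partial_deriv_line[of f i] C_per_partial_deriv[OF r f] in auto)
    then show ?thesis by simp
  qed
  have "\<bar>f (x + (\<Sum>i\<in>J. (y - x) $ i *\<^sub>R axis i 1)) - f x\<bar> \<le> (\<Sum>i\<in>J. \<bar>(y - x) $ i\<bar>)"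
    if "finite J" for J
    using that
  proof (induction J)
    case (insert j J)
    then show ?case
      using step[of "x + (\<Sum>i\<in>J. (y - x) $ i *\<^sub>R axis i 1)" "(y - x) $ j" j]
      by (simp add: algebra_simps)
  qed simp
  from this[of UNIV] have "\<bar>f (x + (y - x)) - f x\<bar> \<le> (\<Sum>i\<in>UNIV. \<bar>(y - x) $ i\<bar>)"
    using basis_expansion[of "y - x"] by (simp add: scalar_mult_eq_scaleR)
  also have "\<dots> \<le> (\<Sum>i\<in>(UNIV::'d set). norm (x - y))"
    by (intro sum_mono) (metis component_le_norm_cart norm_minus_commute)
  finally show ?thesis by (simp add: abs_minus_commute)
qed

text \<open>Sample on a fine finite net and return the integral of any function of the class that matches
  the values, an admissible algorithm because \<open>\<phi>\<close> may be an arbitrary map. Two functions of the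
  class that agree on the net are uniformly close, since the class is uniformly Lipschitz.\<close>
lemma exists_small_minimal_error:
  fixes \<epsilon> :: real
  assumes r: "1 \<le> r" and \<epsilon>: "0 < \<epsilon>"
  shows "\<exists>n. minimal_error n (C_per r :: (real^'d::finite \<Rightarrow> real) set) \<le> ereal \<epsilon>"
proof -
  let ?F = "C_per r :: (real^'d \<Rightarrow> real) set"
  let ?d = "real CARD('d)"
  define \<kappa> where "\<kappa> = \<epsilon> / (2 * ?d)"
  have \<kappa>: "0 < \<kappa>" using \<epsilon> by (simp add: \<kappa>_def)
  obtain K :: "(real^'d) set" where K: "finite K" "K \<subseteq> cbox 0 1" "cbox 0 1 \<subseteq> (\<Union>x\<in>K. ball x \<kappa>)"
    using seq_compact_imp_totally_bounded[OF compact_imp_seq_compact[OF compact_cbox[of 0 "1::real^'d"]]] \<kappa>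
    by metis
  obtain xs where xs: "set xs = K" using finite_list[OF K(1)] by blast
  define n where "n = length xs"
  define \<psi> where "\<psi> ys = xs ! length ys" for ys :: "real list"
  define \<phi> where "\<phi> ys = S_int (SOME f. f \<in> ?F \<and> info \<psi> n f = ys)" for ys
  define A where "A f = \<phi> (info \<psi> n f)" for f
  have len: "length (info \<psi> k f) = k" for k f by (induction k) auto
  have nth: "k < m \<Longrightarrow> info \<psi> m f ! k = f (xs ! k)" for k m f
    by (induction m) (auto simp: nth_append len \<psi>_def less_Suc_eq)
  have "A \<in> algorithms n ?F"
    unfolding algorithms_def using xs K(2)
    by (auto simp: A_def \<psi>_def n_def intro!: exI[of _ \<phi>] exI[of _ \<psi>] subsetD[OF K(2)])
  moreover have "wc_error ?F A \<le> ereal \<epsilon>"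
    unfolding wc_error_def
  proof (rule SUP_least)
    fix f assume f: "f \<in> ?F"
    define g where "g = (SOME g. g \<in> ?F \<and> info \<psi> n g = info \<psi> n f)"
    have g: "g \<in> ?F" "info \<psi> n g = info \<psi> n f"
      using someI[of "\<lambda>g. g \<in> ?F \<and> info \<psi> n g = info \<psi> n f" f] f by (auto simp: g_def)
    have eq: "g p = f p" if p: "p \<in> K" for p
    proof -
      obtain k where "k < n" "p = xs ! k" using p xs by (auto simp: n_def in_set_conv_nth)
      then show ?thesis using nth[of k n f] nth[of k n g] g(2) by simp
    qed
    have close: "\<bar>f x - g x\<bar> \<le> \<epsilon>" if x: "x \<in> cbox 0 1" for x
    proof -
      obtain p where p: "p \<in> K" "norm (x - p) < \<kappa>"
        using K(3) x by (auto simp: dist_norm norm_minus_commute)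
      have "\<bar>f x - g x\<bar> \<le> ?d * norm (x - p) + ?d * norm (x - p)"
        using C_per_lipschitz[OF r f, of x p] C_per_lipschitz[OF r g(1), of x p] eq[OF p(1)]
        by linarith
      also have "\<dots> \<le> ?d * \<kappa> + ?d * \<kappa>"
        using p by (intro add_mono mult_left_mono) auto
      also have "\<dots> = \<epsilon>" by (simp add: \<kappa>_def)
      finally show ?thesis .
    qed
    have int: "u integrable_on cbox 0 1" if "u \<in> ?F" for u
      using C_per_partial_deriv(1)[OF r that]
      by (intro integrable_continuous) (auto intro: continuous_on_subset)
    have "\<bar>S_int f - S_int g\<bar> = norm (integral (cbox 0 1) (\<lambda>x. f x - g x))"
      by (simp add: S_int_def integral_diff int f g)
    also have "\<dots> \<le> \<epsilon> * measure lborel (cbox 0 (1::real^'d))"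
      by (rule has_integral_bound[of _ "\<lambda>x. f x - g x"])
         (use \<epsilon> close int[OF f] int[OF g(1)] in \<open>auto intro!: integrable_integral integrable_diff\<close>)
    finally show "ereal \<bar>S_int f - A f\<bar> \<le> ereal \<epsilon>"
      by (simp add: A_def \<phi>_def g_def content_unit_cbox)
  qed
  ultimately have "minimal_error n ?F \<le> ereal \<epsilon>"
    unfolding minimal_error_def
    using INF_lower2[of A "algorithms n ?F" "wc_error ?F"] by blast
  then show ?thesis ..
qed

section \<open>The lower bound\<close>

text \<open>Each node accounts for at most the fraction \<open>q\<close> of the cube, and \<open>1 / q\<close> is the claimed bound up
  to the factor \<open>1 - \<delta>\<close>. If it failed, then \<open>n * q < 1 - \<delta>\<close> and the fooling functions would
  force an error of more than \<open>(\<epsilon> / \<delta>) * \<delta>\<close>.\<close>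
lemma n_per_lower_bound:
  fixes \<delta> \<epsilon> :: real
  assumes r: "1 \<le> r" and \<delta>: "0 < \<delta>" and \<epsilon>: "0 < \<epsilon>" "\<epsilon> \<le> \<delta>"
  defines "d \<equiv> CARD('d::finite)"
  shows "(1 - \<delta>) * c_const r ^ d * (\<delta> * real d / \<epsilon>) powr (real d / real r)
    \<le> real (n_per TYPE('d) \<epsilon> r)"
proof (rule ccontr)
  let ?F = "C_per r :: (real^'d \<Rightarrow> real) set"
  define n where "n = n_per TYPE('d) \<epsilon> r"
  \<comment> \<open>\<open>h\<close> solves \<open>d * h ^ r = \<epsilon> / \<delta>\<close>; \<open>\<kappa>\<close> is the ratio \<open>(r * h + \<eta>) / h\<close> for which \<open>q\<close> produces
    exactly the constant \<open>c_const r\<close>.\<close>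
  define h where "h = (\<epsilon> / (\<delta> * d)) powr (1 / r)"
  define \<kappa> where "\<kappa> = 2 * real r powr (1 - 1 / r)"
  define \<eta> where "\<eta> = (\<kappa> - r) * h"
  define q where "q = (2 * exp 1 * (r * h + \<eta>)) ^ d"
  have d: "0 < real d" by (simp add: d_def)
  have h: "0 < h" using \<epsilon> \<delta> d by (simp add: h_def)
  have hr: "h ^ r = \<epsilon> / (\<delta> * d)"
    using r \<epsilon> \<delta> d by (simp add: h_def powr_powr flip: powr_realpow)
  have hd: "h ^ d = 1 / (\<delta> * d / \<epsilon>) powr (d / r)"
  proof -
    have "h ^ d = (\<epsilon> / (\<delta> * d)) powr (d / r)"
      using \<epsilon> \<delta> d by (simp add: h_def powr_powr flip: powr_realpow)
    also have "\<epsilon> / (\<delta> * d) = inverse (\<delta> * d / \<epsilon>)" by (simp add: field_simps)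
    finally show ?thesis using \<epsilon> \<delta> d by (simp add: powr_minus inverse_eq_divide powr_divide)
  qed
  \<comment> \<open>The room for \<open>\<eta> > 0\<close>: the inequality \<open>r < \<kappa>\<close> amounts to \<open>r < 2 ^ r\<close>.\<close>
  have "real r powr (1 / r) < 2"
  proof -
    have "real r powr (1 / r) < (2 ^ r) powr (1 / r)"
      using r by (intro powr_less_mono2) auto
    also have "\<dots> = 2" using r by (simp add: powr_powr flip: powr_realpow)
    finally show ?thesis .
  qed
  then have "real r powr (1 / r) * real r powr (1 - 1 / r) < \<kappa>"
    using r by (simp add: \<kappa>_def)
  then have "real r < \<kappa>" using r by (simp flip: powr_add)
  then have \<eta>: "0 < \<eta>" using h by (simp add: \<eta>_def)
  have q: "q = 1 / (c_const r ^ d * (\<delta> * real d / \<epsilon>) powr (real d / real r))"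
  proof -
    have "2 * exp 1 * (r * h + \<eta>) = h / c_const r"
      by (simp add: \<eta>_def \<kappa>_def c_const_def algebra_simps)
    then show ?thesis by (simp add: q_def power_divide hd)
  qed
  assume "\<not> ?thesis"
  then have "real n < (1 - \<delta>) / q" by (simp add: q n_def)
  moreover have "0 < q" using h \<eta> by (simp add: q_def add_nonneg_pos)
  ultimately have nq: "n * q < 1 - \<delta>" by (simp add: field_simps)
  have "ereal (\<epsilon> / \<delta> * (1 - n * q)) \<le> minimal_error n ?F"
  proof (rule minimal_error_lower_bound)
    fix P :: "(real^'d) set" assume P: "finite P" "card P \<le> n"
    have V: "real CARD('d) * h ^ r = \<epsilon> / \<delta>" using d by (simp add: hr d_def)
    then have "real CARD('d) * h ^ r \<le> 1" using \<epsilon> \<delta> by simp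
    from exists_fooling_function[OF P(1) r h \<eta> this] obtain f where
      f: "f \<in> ?F" "(\<lambda>x. - f x) \<in> ?F" "\<forall>p\<in>P. f p = 0" "\<epsilon> / \<delta> * (1 - card P * q) \<le> S_int f"
      unfolding V by (auto simp: q_def d_def)
    have "\<epsilon> / \<delta> * (1 - n * q) \<le> \<epsilon> / \<delta> * (1 - card P * q)"
      using P(2) \<open>0 < q\<close> \<epsilon> \<delta> by (intro mult_left_mono diff_left_mono mult_right_mono) auto
    with f show "\<exists>f\<in>?F. (\<lambda>x. - f x) \<in> ?F \<and> (\<forall>p\<in>P. f p = 0) \<and> \<epsilon> / \<delta> * (1 - n * q) \<le> S_int f"
      using order_trans by blast
  qed
  also have "minimal_error n ?F \<le> ereal \<epsilon>"
    unfolding n_def n_per_def by (rule LeastI_ex[OF exists_small_minimal_error[OF r \<epsilon>(1)]])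
  finally have "\<epsilon> / \<delta> * (1 - n * q) \<le> \<epsilon>" by simp
  moreover have "\<epsilon> / \<delta> * \<delta> < \<epsilon> / \<delta> * (1 - n * q)"
    using nq \<epsilon> \<delta> by (intro mult_strict_left_mono) auto
  ultimately show False using \<delta> by simp
qed

text \<open>The tangent inequality \<open>ln u \<le> u - 1\<close> at \<open>u = (1 - \<delta>) / (1 - s)\<close> and \<open>u = \<delta> / s\<close> with the
  maximizer \<open>s = a / (1 + a)\<close>; the linear terms cancel because \<open>a / s = 1 / (1 - s)\<close>.\<close>
lemma one_minus_times_powr_le:
  fixes a \<delta> :: real
  assumes a: "0 < a" and \<delta>: "0 < \<delta>" "\<delta> < 1"
  shows "(1 - \<delta>) * \<delta> powr a \<le> (1 - a / (1 + a)) * (a / (1 + a)) powr a"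
proof -
  define s where "s = a / (1 + a)"
  have s: "0 < s" "s < 1" "1 - s = 1 / (1 + a)" using a by (auto simp: s_def field_simps)
  have "ln ((1 - \<delta>) / (1 - s)) + a * ln (\<delta> / s) \<le> ((1 - \<delta>) / (1 - s) - 1) + a * (\<delta> / s - 1)"
    using a \<delta> s by (intro add_mono mult_left_mono ln_le_minus_one) auto
  also have "\<dots> = 0" using a unfolding s(3) by (simp add: s_def field_simps)
  finally have "ln (1 - \<delta>) + a * ln \<delta> \<le> ln (1 - s) + a * ln s"
    using a \<delta> s(1,2) by (simp add: ln_div algebra_simps)
  then have "exp (ln (1 - \<delta>) + a * ln \<delta>) \<le> exp (ln (1 - s) + a * ln s)" by simp
  then show ?thesis
    using \<delta> s(1,2) by (simp add: exp_add powr_def flip: s_def)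
qed

theorem proposition1:
  fixes r d :: nat
  assumes r: "r \<ge> 1"
    and d: "d = CARD('d::finite)"
  shows "(\<forall>\<delta> \<epsilon> :: real. 0 < \<delta> \<and> \<delta> < 1 \<and> 0 < \<epsilon> \<and> \<epsilon> \<le> \<delta> \<longrightarrow>
            real (n_per TYPE('d) \<epsilon> r)
              \<ge> (1 - \<delta>) * c_const r ^ d * (\<delta> * real d / \<epsilon>) powr (real d / real r))
       \<and> (\<forall>\<epsilon> :: real. 0 < \<epsilon> \<longrightarrow>
            is_arg_max
              (\<lambda>\<delta>. (1 - \<delta>) * c_const r ^ d * (\<delta> * real d / \<epsilon>) powr (real d / real r))
              (\<lambda>\<delta>. 0 < \<delta> \<and> \<delta> < 1)
              (real d / (real d + real r)))
       \<and> (\<forall>\<epsilon> :: real. 0 < \<epsilon> \<and> \<epsilon> \<le> real d / (real d + real r) \<longrightarrow>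
            real (n_per TYPE('d) \<epsilon> r)
              \<ge> real r / (real r + real d) *
                (real d / (real d + real r) *
                 (1 / (4 ^ r * exp 1 ^ r * real r ^ (r - 1))) *
                 (real d / \<epsilon>)) powr (real d / real r))"
proof (intro conjI allI impI)
  fix \<delta> \<epsilon> :: real
  assume "0 < \<delta> \<and> \<delta> < 1 \<and> 0 < \<epsilon> \<and> \<epsilon> \<le> \<delta>"
  then show "(1 - \<delta>) * c_const r ^ d * (\<delta> * real d / \<epsilon>) powr (real d / real r)
      \<le> real (n_per TYPE('d) \<epsilon> r)"
    unfolding d by (intro n_per_lower_bound r) auto
next
  have dr: "0 < real d" "0 < real r" using r d by auto
  have c: "0 < c_const r" using r by (simp add: c_const_def)
  fix \<epsilon> :: real assume \<epsilon>: "0 < \<epsilon>"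
  let ?s = "real d / (real d + real r)"
  let ?a = "real d / real r"
  let ?C = "c_const r ^ d * (real d / \<epsilon>) powr ?a"
  have eq: "(1 - \<delta>) * c_const r ^ d * (\<delta> * real d / \<epsilon>) powr ?a = ?C * ((1 - \<delta>) * \<delta> powr ?a)"
    if "0 < \<delta>" for \<delta>
    using that powr_mult[of \<delta> "real d / \<epsilon>" ?a] \<epsilon> dr by (simp add: mult_ac)
  have s: "0 < ?s" "?s < 1" "?s = ?a / (1 + ?a)" using dr by (auto simp: field_simps)
  have "?C * ((1 - \<delta>) * \<delta> powr ?a) \<le> ?C * ((1 - ?s) * ?s powr ?a)" if "0 < \<delta>" "\<delta> < 1" for \<delta>
    unfolding s(3) using that c dr by (intro mult_left_mono one_minus_times_powr_le) auto
  then have "(1 - \<delta>) * c_const r ^ d * (\<delta> * real d / \<epsilon>) powr ?a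
      \<le> (1 - ?s) * c_const r ^ d * (?s * real d / \<epsilon>) powr ?a" if "0 < \<delta>" "\<delta> < 1" for \<delta>
    using that by (simp only: eq s(1))
  then show "is_arg_max
      (\<lambda>\<delta>. (1 - \<delta>) * c_const r ^ d * (\<delta> * real d / \<epsilon>) powr ?a) (\<lambda>\<delta>. 0 < \<delta> \<and> \<delta> < 1) ?s"
    unfolding is_arg_max_def using s(1,2) by (meson not_less)
next
  fix \<epsilon> :: real
  let ?s = "real d / (real d + real r)"
  let ?a = "real d / real r"
  assume \<epsilon>: "0 < \<epsilon> \<and> \<epsilon> \<le> ?s"
  have dr: "0 < real d" "0 < real r" using r d by auto
  have c: "0 < c_const r" using r by (simp add: c_const_def)
  have "c_const r ^ r = 1 / (4 ^ r * exp 1 ^ r * real r ^ (r - 1))"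
  proof -
    have "(1 - 1 / r) * r = real (r - 1)" using r by (simp add: of_nat_diff left_diff_distrib)
    then have "(real r powr (1 - 1 / r)) ^ r = real r powr (real (r - 1))"
      using r by (simp add: powr_powr flip: powr_realpow)
    also have "\<dots> = real r ^ (r - 1)" using r by (intro powr_realpow) simp
    finally show ?thesis by (simp add: c_const_def power_divide power_mult_distrib)
  qed
  moreover have "(c_const r ^ r) powr ?a = c_const r ^ d"
    using c dr by (simp add: powr_powr flip: powr_realpow)
  ultimately have "(?s * (1 / (4 ^ r * exp 1 ^ r * real r ^ (r - 1))) * (real d / \<epsilon>)) powr ?a
      = c_const r ^ d * (?s * real d / \<epsilon>) powr ?a"
    using powr_mult[of "c_const r ^ r" "?s * real d / \<epsilon>" ?a] c dr \<epsilon> by (simp add: mult_ac)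
  moreover have "1 - ?s = real r / (real r + real d)" using dr by (simp add: field_simps)
  moreover have "(1 - ?s) * c_const r ^ d * (?s * real d / \<epsilon>) powr ?a \<le> real (n_per TYPE('d) \<epsilon> r)"
    using \<epsilon> dr unfolding d by (intro n_per_lower_bound r) auto
  ultimately show "real r / (real r + real d) *
      (?s * (1 / (4 ^ r * exp 1 ^ r * real r ^ (r - 1))) * (real d / \<epsilon>)) powr ?a
      \<le> real (n_per TYPE('d) \<epsilon> r)"
    by (simp add: mult.assoc)
qed

end
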